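(* For all $p,q,r\ge 0$ with $n=p+q+r\ge 1$, the Lie algebras $\mathfrak{p}^{\pm}_{p,q,r}$, $\mathfrak{p}^{\pm\Lambda}_{p,q,r}$, $\mathfrak{p}^{\pm\mathrm{rad}}_{p,q,r}$, $\mathfrak{p}_{p,q,r}$, $\mathfrak{p}^{\Lambda}_{p,q,r}$ of the Lie groups $\mathrm{P}^{\pm}_{p,q,r}$, $\mathrm{P}^{\pm\Lambda}_{p,q,r}$, $\mathrm{P}^{\pm\mathrm{rad}}_{p,q,r}$, $\mathrm{P}_{p,q,r}$, $\mathrm{P}^{\Lambda}_{p,q,r}$ respectively are the following subspaces of $\mathcal{G}_{p,q,r}$, considered with respect to the commutator $[U,V]=UV-VU$: $\mathfrak{p}^{\pm}_{p,q,r}=\mathcal{G}^{(0)}_{p,q,r}$; $\mathfrak{p}^{\pm\Lambda}_{p,q,r}=\mathcal{G}^{(0)}_{p,q,r}\oplus\Lambda^{(1)}_r$; $\mathfrak{p}^{\pm\mathrm{rad}}_{p,q,r}=\mathcal{G}^{(0)}_{p,q,r}\oplus\mathrm{rad}\,\mathcal{G}^{(1)}_{p,q,r}$; $\mathfrak{p}_{p,q,r}=\mathcal{G}^{(0)}_{p,q,r}\oplus\mathcal{G}^{n}_{p,q,r}$ if $n$ is odd, and $\mathfrak{p}_{p,q,r}=\mathcal{G}^{(0)}_{p,q,r}$ if $n$ is even; $\mathfrak{p}^{\Lambda}_{p,q,r}=\mathcal{G}^{(0)}_{p,q,r}\oplus\Lambda^{(1)}_r\oplus\mathcal{G}^{n}_{p,q,r}$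 if $n$ is odd and $n\neq r$, and $\mathfrak{p}^{\Lambda}_{p,q,r}=\mathcal{G}^{(0)}_{p,q,r}\oplus\Lambda^{(1)}_r$ in the other cases. Their dimensions are: $\dim\mathfrak{p}^{\pm}_{p,q,r}=2^{n-1}$; $\dim\mathfrak{p}^{\pm\Lambda}_{p,q,r}=2^{n-1}+2^{r-1}$ if $r\ge 1$, and $2^{n-1}$ if $r=0$; $\dim\mathfrak{p}^{\pm\mathrm{rad}}_{p,q,r}=2^{n}-2^{p+q-1}$ if $p+q\ge 1$, and $2^{n}$ if $p=q=0$; $\dim\mathfrak{p}_{p,q,r}=2^{n-1}+1$ if $n$ is odd, and $2^{n-1}$ if $n$ is even; $\dim\mathfrak{p}^{\Lambda}_{p,q,r}=2^{n-1}+2^{r-1}+1$ if $n$ is odd, $n\neq r$, $r\ge 1$; $\ 2^{n-1}+1$ if $n$ is odd and $r=0$; $\ 2^{n-1}$ if $n$ is even and $r=0$; and $2^{n-1}+2^{r-1}$ in the other cases.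
   Context: Let $\mathbb{F}=\mathbb{R}$ or $\mathbb{F}=\mathbb{C}$, let $p,q,r\ge 0$ be integers and $n=p+q+r\ge 1$. $\mathcal{G}_{p,q,r}$ denotes the (Clifford) geometric algebra: the unital associative $\mathbb{F}$-algebra of dimension $2^n$ with identity $e$ and generators $e_1,\dots,e_n$ satisfying $e_ae_b+e_be_a=2\eta_{ab}e$, where $\eta$ is the diagonal matrix whose diagonal is $p$ times $1$, then $q$ times $-1$, then $r$ times $0$ (if $\mathbb{F}=\mathbb{R}$), or $p+q$ times $1$, then $r$ times $0$ (if $\mathbb{F}=\mathbb{C}$). A basis is given by $e_{a_1\ldots a_k}:=e_{a_1}\cdots e_{a_k}$, $a_1<\dots<a_k$, $0\le k\le n$ (the empty product being $e$); $\mathcal{G}^k_{p,q,r}$ (grade $k$) is the span of those with $k$ indices, and $\mathcal{G}^0=\mathbb{F}e$. Dimensions are over $\mathbb{F}$. The grade involution $U\mapsto\widehat U$ is the algebra automorphism with $\widehat{e_a}=-e_a$. $\mathcal{G}^{(k)}_{p,q,r}=\{U:\widehat U=(-1)^kU\}$, $k=0,1$ (even and odd subspaces). $\Lambda_r=\mathcal{G}_{0,0,r}$ is the (Grassmann) subalgebra generated by $e$ and the null generators $e_{p+q+1},\dots,e_n$ ($\Lambda_0=\mathcal{G}^0$), and $\Lambda_r^{(k)}=\Lambda_r\cap\mathcal{G}^{(k)}_{p,q,r}$. $\mathrm{rad}\,\mathcal{G}_{p,q,r}$ is the Jacobson radical of $\mathcal{G}_{p,q,r}$; it is the span of the basis elements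 $e_{a_1\ldots a_k}$ containing at least one index from $\{p+q+1,\dots,n\}$ (it is $\{0\}$ if $r=0$). $\mathrm{rad}\,\mathcal{G}^{(1)}_{p,q,r}$ denotes its odd part $\mathrm{rad}\,\mathcal{G}_{p,q,r}\cap\mathcal{G}^{(1)}_{p,q,r}$. For a subset $A\subseteq\mathcal{G}_{p,q,r}$, $A^\times$ denotes the set of elements of $A$ invertible in $\mathcal{G}_{p,q,r}$. A product of subsets is the set of products of their elements. $\mathrm{Z}_{p,q,r}$ is the center of $\mathcal{G}_{p,q,r}$; it equals $\Lambda^{(0)}_r\oplus\mathcal{G}^n_{p,q,r}$ if $n$ is odd and $\Lambda^{(0)}_r$ if $n$ is even. Lie groups (subgroups of $\mathcal{G}^\times_{p,q,r}$): $\mathrm{P}^{\pm}_{p,q,r}:=\mathcal{G}^{(0)\times}_{p,q,r}\cup\mathcal{G}^{(1)\times}_{p,q,r}$, $\mathrm{P}_{p,q,r}:=\mathrm{P}^{\pm}_{p,q,r}\mathrm{Z}^{\times}_{p,q,r}$, $\mathrm{P}^{\pm\Lambda}_{p,q,r}:=\mathrm{P}^{\pm}_{p,q,r}\Lambda_r^{\times}$, $\mathrm{P}^{\Lambda}_{p,q,r}:=\mathrm{P}_{p,q,r}\Lambda_r^{\times}$, $\mathrm{P}^{\pm\mathrm{rad}}_{p,q,r}:=\mathrm{P}^{\pm}_{p,q,r}(\mathcal{G}^{0}\oplus\mathrm{rad}\,\mathcal{G}_{p,q,r})^{\times}$. *)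

theory Defs
  imports "HOL-Analysis.Analysis" "HOL-Library.Function_Algebras"
begin

section \<open>The scalar field\<close>

text \<open>
  Normed fields that are a copy of the reals or of the complex numbers. The only purpose of the
  class is to treat the real and the complex case in one statement.
\<close>

class real_or_complex = real_normed_field +
  assumes real_or_complex:
    "(\<forall>z. \<exists>x. z = scaleR x 1) \<or> (\<exists>i. i * i = -1 \<and> (\<forall>z. \<exists>x y. z = scaleR x 1 + scaleR y i))"

instance real :: real_or_complex
  by standard auto

instance complex :: real_or_complex
proof
  have "\<i> * \<i> = -1 \<and> (\<forall>z. \<exists>x y. z = scaleR x 1 + scaleR y \<i>)"
    by (auto simp: complex_eq_iff)
  then show "(\<forall>z::complex. \<exists>x. z = scaleR x 1) \<or>
      (\<exists>i::complex. i * i = -1 \<and> (\<forall>z. \<exists>x y. z = scaleR x 1 + scaleR y i))"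
    by blast
qed


section \<open>The geometric algebra\<close>

text \<open>
  A multivector is given by its coordinates in the basis indexed by the subsets of
  \<open>{1..p+q+r}\<close>. Addition is the pointwise one of \<^theory>\<open>HOL-Library.Function_Algebras\<close>; the
  pointwise multiplication and unit of that theory play no role.
\<close>

type_synonym 'f mv = "nat set \<Rightarrow> 'f"

definition mv_scale :: "'f::real_or_complex \<Rightarrow> 'f mv \<Rightarrow> 'f mv" where
  "mv_scale c U = (\<lambda>A. c * U A)"

global_interpretation mv: vector_space mv_scale
  by standard (auto simp: mv_scale_def algebra_simps fun_eq_iff)

definition ga :: "nat \<Rightarrow> nat \<Rightarrow> nat \<Rightarrow> 'f::real_or_complex mv set" where
  "ga p q r = {U. \<forall>A. \<not> A \<subseteq> {1..p+q+r} \<longrightarrow> U A = 0}"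

text \<open>
  The diagonal of the matrix of the form. The \<open>q\<close> generators of the second kind square to \<open>-1\<close>
  over the reals and to \<open>1\<close> over the complex numbers; the two fields are told apart by the
  existence of a square root of \<open>-1\<close>.
\<close>

definition ga_eta :: "nat \<Rightarrow> nat \<Rightarrow> nat \<Rightarrow> nat \<Rightarrow> 'f::real_or_complex" where
  "ga_eta p q r a =
     (if a \<le> p then 1
      else if a \<le> p + q then (if \<exists>i::'f. i * i = -1 then 1 else -1)
      else 0)"

definition blade :: "nat set \<Rightarrow> 'f::real_or_complex mv" where
  "blade A = (\<lambda>B. if B = A then 1 else 0)"

abbreviation ga_one :: "'f::real_or_complex mv" where
  "ga_one \<equiv> blade {}"

abbreviation ga_gen :: "nat \<Rightarrow> 'f::real_or_complex mv" where
  "ga_gen a \<equiv> blade {a}"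

text \<open>
  Writing the ordered products for \<open>A\<close> and \<open>B\<close> next to each other and sorting the generators costs
  one sign for every pair of distinct generators standing in the wrong order; afterwards the
  generators indexed by \<open>A \<inter> B\<close> occur squared. Thus
  \<open>e\<^sub>A e\<^sub>B = ga_coef A B e\<^sub>C\<close>, where \<open>C\<close> is the symmetric difference of \<open>A\<close> and \<open>B\<close>.
\<close>

definition ga_coef :: "nat \<Rightarrow> nat \<Rightarrow> nat \<Rightarrow> nat set \<Rightarrow> nat set \<Rightarrow> 'f::real_or_complex" where
  "ga_coef p q r A B =
     (-1) ^ card {(a, b). a \<in> A \<and> b \<in> B \<and> b < a} * (\<Prod>a\<in>A \<inter> B. ga_eta p q r a)"

definition ga_mul :: "nat \<Rightarrow> nat \<Rightarrow> nat \<Rightarrow> 'f::real_or_complex mv \<Rightarrow> 'f mv \<Rightarrow> 'f mv" where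
  "ga_mul p q r U V =
     (\<Sum>A\<in>Pow {1..p+q+r}. \<Sum>B\<in>Pow {1..p+q+r}.
        mv_scale (U A * V B * ga_coef p q r A B) (blade ((A - B) \<union> (B - A))))"

definition grade_inv :: "'f::real_or_complex mv \<Rightarrow> 'f mv" where
  "grade_inv U = (\<lambda>A. (-1) ^ card A * U A)"


subsection \<open>The model is the algebra with the stated generators and relations\<close>

lemma blade_in_ga: "A \<subseteq> {1..p+q+r} \<Longrightarrow> blade A \<in> ga p q r"
  by (auto simp: ga_def blade_def)

lemma ga_subspace: "mv.subspace (ga p q r)"
  by (auto simp: mv.subspace_def ga_def mv_scale_def)

lemma mv_sum_apply: "(\<Sum>i\<in>I. f i) A = (\<Sum>i\<in>I. (f i :: 'f::real_or_complex mv) A)"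
  by (induction I rule: infinite_finite_induct) auto

lemma ga_mul_apply:
  "ga_mul p q r U V C =
     (\<Sum>A\<in>Pow {1..p+q+r}. \<Sum>B\<in>Pow {1..p+q+r}.
        if C = (A - B) \<union> (B - A) then U A * V B * ga_coef p q r A B else 0)"
  unfolding ga_mul_def mv_sum_apply
  by (intro sum.cong refl) (simp add: mv_scale_def blade_def)

lemma ga_mul_closed: "ga_mul p q r U V \<in> ga p q r"
proof -
  have "ga_mul p q r U V C = 0" if "\<not> C \<subseteq> {1..p+q+r}" for C
    unfolding ga_mul_apply by (rule sum.neutral, intro ballI, rule sum.neutral) (use that in auto)
  then show ?thesis by (simp add: ga_def)
qed

lemma ga_mul_add_left: "ga_mul p q r (U + U') V = ga_mul p q r U V + ga_mul p q r U' V"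
  by (rule ext) (simp add: ga_mul_apply flip: sum.distrib, intro sum.cong refl, simp add: algebra_simps)

lemma ga_mul_add_right: "ga_mul p q r U (V + V') = ga_mul p q r U V + ga_mul p q r U V'"
  by (rule ext) (simp add: ga_mul_apply flip: sum.distrib, intro sum.cong refl, simp add: algebra_simps)

lemma ga_mul_scale_left: "ga_mul p q r (mv_scale c U) V = mv_scale c (ga_mul p q r U V)"
  by (rule ext) (simp add: ga_mul_apply mv_scale_def sum_distrib_left, intro sum.cong refl, simp)

lemma ga_mul_scale_right: "ga_mul p q r U (mv_scale c V) = mv_scale c (ga_mul p q r U V)"
  by (rule ext) (simp add: ga_mul_apply mv_scale_def sum_distrib_left, intro sum.cong refl, simp)

lemma ga_mul_zero_left: "ga_mul p q r 0 V = 0"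
  using ga_mul_scale_left[of p q r 0 0 V] by simp

lemma ga_mul_zero_right: "ga_mul p q r U 0 = 0"
  using ga_mul_scale_right[of p q r U 0 0] by simp

lemma ga_mul_sum_left: "ga_mul p q r (\<Sum>i\<in>I. f i) V = (\<Sum>i\<in>I. ga_mul p q r (f i) V)"
  by (induction I rule: infinite_finite_induct) (simp_all only: sum.infinite sum.empty sum.insert ga_mul_add_left ga_mul_zero_left not_False_eq_True)

lemma ga_mul_sum_right: "ga_mul p q r U (\<Sum>i\<in>I. f i) = (\<Sum>i\<in>I. ga_mul p q r U (f i))"
  by (induction I rule: infinite_finite_induct) (simp_all only: sum.infinite sum.empty sum.insert ga_mul_add_right ga_mul_zero_right not_False_eq_True)

lemma blade_mul:
  assumes "A \<subseteq> {1..p+q+r}" "B \<subseteq> {1..p+q+r}"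
  shows "ga_mul p q r (blade A) (blade B :: 'f::real_or_complex mv) =
           mv_scale (ga_coef p q r A B) (blade ((A - B) \<union> (B - A)))"
proof -
  let ?N = "Pow {1..p+q+r}"
  let ?T = "mv_scale (ga_coef p q r A B) (blade ((A - B) \<union> (B - A))) :: 'f mv"
  have "(\<Sum>B'\<in>?N. mv_scale (blade A A' * blade B B' * ga_coef p q r A' B')
            (blade ((A' - B') \<union> (B' - A')))) = (if A' = A then ?T else 0)" for A'
  proof (cases "A' = A")
    case True
    have "(\<Sum>B'\<in>?N. mv_scale (blade A A' * blade B B' * ga_coef p q r A' B')
            (blade ((A' - B') \<union> (B' - A')))) = (\<Sum>B'\<in>?N. if B' = B then ?T else 0)"
      using True by (intro sum.cong refl) (simp add: blade_def[of A] blade_def[of B])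
    then show ?thesis
      using True assms by simp
  next
    case False
    then show ?thesis
      by (simp add: blade_def[of A])
  qed
  then show ?thesis
    using assms unfolding ga_mul_def by simp
qed

lemma mv_expand:
  assumes "U \<in> ga p q r"
  shows "U = (\<Sum>A\<in>Pow {1..p+q+r}. mv_scale (U A) (blade A))"
proof (rule ext)
  fix B
  have "(\<Sum>A\<in>Pow {1..p+q+r}. mv_scale (U A) (blade A)) B =
      (\<Sum>A\<in>Pow {1..p+q+r}. if A = B then U A else 0)"
    unfolding mv_sum_apply by (intro sum.cong refl) (auto simp: mv_scale_def blade_def)
  also have "\<dots> = U B"
    using assms by (auto simp: sum.delta' ga_def)
  finally show "U B = (\<Sum>A\<in>Pow {1..p+q+r}. mv_scale (U A) (blade A)) B" ..
qed

lemma ga_induct [consumes 1, case_names blade add scale]: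
  assumes "U \<in> ga p q r"
    and "\<And>A. A \<subseteq> {1..p+q+r} \<Longrightarrow> P (blade A)"
    and "\<And>U V. P U \<Longrightarrow> P V \<Longrightarrow> P (U + V)"
    and "\<And>c U. P U \<Longrightarrow> P (mv_scale c U)"
  shows "P U"
proof -
  have "P (mv_scale 0 (blade {}))"
    by (intro assms) simp
  then have zero: "P 0"
    by (simp add: mv_scale_def zero_fun_def)
  have "P (\<Sum>A\<in>\<A>. mv_scale (U A) (blade A))" if "\<A> \<subseteq> Pow {1..p+q+r}" for \<A>
    using finite_subset[OF that] that
    by (induction \<A> rule: finite_induct) (auto simp: zero intro!: assms(2-4))
  then show ?thesis
    using mv_expand[OF assms(1)] by (metis order_refl)
qed

lemma ga_coef_prod:
  assumes "finite A" "finite B"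
  shows "ga_coef p q r A B =
    (\<Prod>a\<in>A. \<Prod>b\<in>B. if b < a then -1 else 1) * (\<Prod>a\<in>A \<inter> B. ga_eta p q r a)"
proof -
  have eq: "{(a, b). a \<in> A \<and> b \<in> B \<and> b < a} = {x \<in> A \<times> B. snd x < fst x}"
    by auto
  have "(\<Prod>a\<in>A. \<Prod>b\<in>B. if b < a then -1 else (1::'a)) =
      (\<Prod>x\<in>A \<times> B. if snd x < fst x then -1 else 1)"
    by (simp add: prod.cartesian_product split_beta)
  also have "\<dots> = (\<Prod>x\<in>{x \<in> A \<times> B. snd x < fst x}. -1)"
    using assms by (subst prod.inter_filter) auto
  finally show ?thesis
    by (simp add: ga_coef_def eq)
qed

lemma prod_sym_diff:
  fixes g :: "'b \<Rightarrow> 'f::real_or_complex"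
  assumes "finite A" "finite B" "\<And>x. g x * g x = 1"
  shows "(\<Prod>x\<in>(A - B) \<union> (B - A). g x) = prod g A * prod g B"
proof -
  have "prod g A = prod g (A - B) * prod g (A \<inter> B)"
    using assms prod.union_disjoint[of "A - B" "A \<inter> B" g]
    by (simp add: Un_Diff_Int Int_Diff_disjoint) (metis Diff_disjoint Diff_Int_distrib2 Int_Diff Un_Diff_Int inf_commute)
  moreover have "prod g B = prod g (B - A) * prod g (A \<inter> B)"
    using assms prod.union_disjoint[of "B - A" "A \<inter> B" g]
    by (simp add: Un_Diff_Int Int_Diff_disjoint) (metis Diff_disjoint Diff_Int_distrib2 Int_Diff Un_Diff_Int inf_commute)
  moreover have "prod g (A \<inter> B) * prod g (A \<inter> B) = 1"
    using assms(3) by (simp flip: prod.distrib)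
  moreover have "(\<Prod>x\<in>(A - B) \<union> (B - A). g x) = prod g (A - B) * prod g (B - A)"
    using assms by (intro prod.union_disjoint) auto
  ultimately show ?thesis
    by (metis (no_types, lifting) mult.assoc mult.commute mult.right_neutral)
qed

lemma ga_coef_cocycle:
  assumes [simp]: "finite A" "finite B" "finite C"
  shows "ga_coef p q r A B * ga_coef p q r ((A - B) \<union> (B - A)) C =
         ga_coef p q r B C * (ga_coef p q r A ((B - C) \<union> (C - B)) :: 'f::real_or_complex)"
proof -
  define s :: "nat \<Rightarrow> nat \<Rightarrow> 'f" where "s = (\<lambda>a b. if b < a then -1 else 1)"
  define S where "S = (\<lambda>A B. \<Prod>a\<in>A. \<Prod>b\<in>B. s a b)"
  define E :: "nat set \<Rightarrow> 'f" where "E = (\<lambda>A. \<Prod>a\<in>A. ga_eta p q r a)"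
  have s: "s a b * s a b = 1" for a b by (simp add: s_def)
  have coef: "ga_coef p q r X Y = S X Y * E (X \<inter> Y)" if "finite X" "finite Y" for X Y
    using that by (simp add: ga_coef_prod S_def E_def s_def)
  have S1: "S ((A - B) \<union> (B - A)) C = S A C * S B C"
    unfolding S_def by (rule prod_sym_diff) (auto simp: s simp flip: prod.distrib)
  have S2: "S A ((B - C) \<union> (C - B)) = S A B * S A C"
    unfolding S_def by (simp add: prod_sym_diff s prod.distrib)
  have "E (A \<inter> B) * E (((A - B) \<union> (B - A)) \<inter> C) = E ((A \<inter> B) \<union> (((A - B) \<union> (B - A)) \<inter> C))"
    unfolding E_def by (rule prod.union_disjoint[symmetric]) auto
  also have "(A \<inter> B) \<union> (((A - B) \<union> (B - A)) \<inter> C) = (B \<inter> C) \<union> (A \<inter> ((B - C) \<union> (C - B)))"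
    by auto
  also have "E \<dots> = E (B \<inter> C) * E (A \<inter> ((B - C) \<union> (C - B)))"
    unfolding E_def by (rule prod.union_disjoint) auto
  finally have "E (A \<inter> B) * E (((A - B) \<union> (B - A)) \<inter> C) =
      E (B \<inter> C) * E (A \<inter> ((B - C) \<union> (C - B)))" .
  then show ?thesis
    by (simp add: coef S1 S2 algebra_simps)
qed

theorem ga_mul_assoc:
  assumes "U \<in> ga p q r" "V \<in> ga p q r" "W \<in> ga p q r"
  shows "ga_mul p q r (ga_mul p q r U V) W = ga_mul p q r U (ga_mul p q r V W)"
  using assms(1)
proof (induction rule: ga_induct)
  case (blade A)
  show ?case using assms(2)
  proof (induction rule: ga_induct)
    case (blade B)
    show ?case using assms(3)
    proof (induction rule: ga_induct)
      case (blade C)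
      have fin: "finite A" "finite B" "finite C"
        using \<open>A \<subseteq> _\<close> \<open>B \<subseteq> _\<close> \<open>C \<subseteq> _\<close> by (auto intro: finite_subset)
      have sub: "(A - B) \<union> (B - A) \<subseteq> {1..p+q+r}" "(B - C) \<union> (C - B) \<subseteq> {1..p+q+r}"
        using \<open>A \<subseteq> _\<close> \<open>B \<subseteq> _\<close> \<open>C \<subseteq> _\<close> by auto
      have eq: "(((A - B) \<union> (B - A)) - C) \<union> (C - ((A - B) \<union> (B - A))) =
          (A - ((B - C) \<union> (C - B))) \<union> (((B - C) \<union> (C - B)) - A)"
        by auto
      show ?case
        unfolding blade_mul[OF \<open>A \<subseteq> _\<close> \<open>B \<subseteq> _\<close>] blade_mul[OF \<open>B \<subseteq> _\<close> \<open>C \<subseteq> _\<close>]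
          ga_mul_scale_left ga_mul_scale_right
          blade_mul[OF sub(1) \<open>C \<subseteq> _\<close>] blade_mul[OF \<open>A \<subseteq> _\<close> sub(2)] eq mv.scale_scale
          ga_coef_cocycle[OF fin] ..
    qed (simp_all only: ga_mul_add_right ga_mul_scale_right)
  qed (simp_all only: ga_mul_add_left ga_mul_add_right ga_mul_scale_left ga_mul_scale_right)
qed (simp_all only: ga_mul_add_left ga_mul_scale_left)

theorem ga_mul_one:
  assumes "U \<in> ga p q r"
  shows "ga_mul p q r ga_one U = U" "ga_mul p q r U ga_one = U"
  using assms
proof (induction rule: ga_induct)
  case (blade A)
  { case 1 show ?case using blade by (simp add: blade_mul ga_coef_def) }
  { case 2 show ?case using blade by (simp add: blade_mul ga_coef_def) }
qed (simp_all add: ga_mul_add_left ga_mul_add_right ga_mul_scale_left ga_mul_scale_right)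

theorem ga_gen_relations:
  assumes "a \<in> {1..p+q+r}" "b \<in> {1..p+q+r}"
  shows "ga_mul p q r (ga_gen a) (ga_gen b) + ga_mul p q r (ga_gen b) (ga_gen a) =
           mv_scale (2 * (if a = b then ga_eta p q r a else 0)) ga_one"
proof -
  have pairs: "{(x, y). x = c \<and> y = d \<and> y < x} = (if d < c then {(c, d)} else {})" for c d :: nat
    by auto
  show ?thesis
  proof (cases "a = b")
    case True
    then show ?thesis using assms
      by (simp add: blade_mul ga_coef_def pairs mv_scale_def fun_eq_iff)
  next
    case False
    have "({b} - {a}) \<union> ({a} - {b}) = ({a} - {b}) \<union> ({b} - {a})" by auto
    then show ?thesis using assms False
      by (auto simp: blade_mul ga_coef_def pairs mv_scale_def fun_eq_iff)
  qed
qed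

text \<open>The basis element of \<open>A\<close> is the ordered product of the generators with indices in \<open>A\<close>.\<close>

theorem blade_eq_ordered_product:
  assumes "A \<subseteq> {1..p+q+r}"
  shows "(blade A :: 'f::real_or_complex mv) =
           foldr (ga_mul p q r) (map ga_gen (sorted_list_of_set A)) ga_one"
proof -
  have "(blade (set xs) :: 'f mv) = foldr (ga_mul p q r) (map ga_gen xs) ga_one"
    if "sorted_wrt (<) xs" "set xs \<subseteq> {1..p+q+r}" for xs
    using that
  proof (induction xs)
    case (Cons a xs)
    have *: "{(x, y). x = a \<and> y \<in> set xs \<and> y < x} = {}" and "a \<notin> set xs"
      using Cons.prems by auto
    then have "(blade (set (a # xs)) :: 'f mv) = ga_mul p q r (ga_gen a) (blade (set xs))"
      using Cons.prems by (subst blade_mul) (auto simp: ga_coef_def *)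
    also have "(blade (set xs) :: 'f mv) = foldr (ga_mul p q r) (map ga_gen xs) ga_one"
      using Cons.prems by (intro Cons.IH) auto
    finally show ?case by simp
  qed simp
  from this[of "sorted_list_of_set A"] show ?thesis
    using assms finite_subset[OF assms] by simp
qed

theorem grade_inv_automorphism:
  "grade_inv (U + V) = grade_inv U + grade_inv V"
  "grade_inv (mv_scale c U) = mv_scale c (grade_inv U)"
  "grade_inv (ga_mul p q r U V) = ga_mul p q r (grade_inv U) (grade_inv V)"
  "grade_inv ga_one = ga_one"
  "grade_inv (ga_gen a) = - ga_gen a"
proof -
  have parity: "(-1) ^ card ((A - B) \<union> (B - A)) = ((-1) ^ card A * (-1) ^ card B :: 'a)"
    if "finite A" "finite B" for A B :: "nat set"
    using prod_sym_diff[OF that, of "\<lambda>_. -1"] by simp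
  show "grade_inv (ga_mul p q r U V) = ga_mul p q r (grade_inv U) (grade_inv V)"
  proof (rule ext)
    fix C
    show "grade_inv (ga_mul p q r U V) C = ga_mul p q r (grade_inv U) (grade_inv V) C"
      unfolding grade_inv_def ga_mul_apply sum_distrib_left
      by (intro sum.cong refl) (auto simp: parity finite_subset[OF _ finite_atLeastAtMost])
  qed
qed (auto simp: grade_inv_def mv_scale_def blade_def fun_eq_iff algebra_simps)

theorem ga_basis:
  "mv.independent (blade ` Pow {1..p+q+r} :: 'f::real_or_complex mv set)"
  "mv.span (blade ` Pow {1..p+q+r} :: 'f mv set) = ga p q r"
  "mv.dim (ga p q r :: 'f mv set) = 2 ^ (p + q + r)"
proof -
  let ?N = "Pow {1..p+q+r}"
  have inj: "inj (blade :: nat set \<Rightarrow> 'f mv)"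
    by (rule injI) (metis blade_def zero_neq_one)
  show ind: "mv.independent (blade ` ?N :: 'f mv set)"
  proof (rule mv.independent_if_scalars_zero)
    fix f :: "'f mv \<Rightarrow> 'f" and x :: "'f mv"
    assume 0: "(\<Sum>x\<in>blade ` ?N. mv_scale (f x) x) = 0" and "x \<in> blade ` ?N"
    then obtain A where A: "A \<in> ?N" "x = blade A" by auto
    have "0 = (\<Sum>B\<in>?N. mv_scale (f (blade B)) (blade B)) A"
      using 0 by (simp add: sum.reindex inj_on_subset[OF inj])
    also have "\<dots> = (\<Sum>B\<in>?N. if B = A then f (blade B) else 0)"
      unfolding mv_sum_apply by (intro sum.cong refl) (auto simp: mv_scale_def blade_def)
    also have "\<dots> = f x"
      using A by simp
    finally show "f x = 0" ..
  qed simp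
  show span: "mv.span (blade ` ?N :: 'f mv set) = ga p q r"
  proof (rule mv.span_subspace)
    show "ga p q r \<subseteq> mv.span (blade ` ?N :: 'f mv set)"
    proof
      fix U :: "'f mv" assume "U \<in> ga p q r"
      then show "U \<in> mv.span (blade ` ?N)"
        by (induction rule: ga_induct) (blast intro: mv.span_base mv.span_add mv.span_scale)+
    qed
  qed (auto simp: blade_in_ga ga_subspace)
  have "mv.dim (ga p q r :: 'f mv set) = card (blade ` ?N :: 'f mv set)"
    using mv.dim_eq_card_independent[OF ind] span mv.dim_span by metis
  then show "mv.dim (ga p q r :: 'f mv set) = 2 ^ (p + q + r)"
    by (simp add: card_image inj_on_subset[OF inj] card_Pow)
qed


section \<open>Subspaces and subsets\<close>

definition grade :: "nat \<Rightarrow> nat \<Rightarrow> nat \<Rightarrow> nat \<Rightarrow> 'f::real_or_complex mv set" where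
  "grade p q r k = mv.span (blade ` {A. A \<subseteq> {1..p+q+r} \<and> card A = k})"

definition ga_par :: "nat \<Rightarrow> nat \<Rightarrow> nat \<Rightarrow> nat \<Rightarrow> 'f::real_or_complex mv set" where
  "ga_par p q r k = {U \<in> ga p q r. grade_inv U = mv_scale ((-1) ^ k) U}"

definition ga_subalgebra :: "nat \<Rightarrow> nat \<Rightarrow> nat \<Rightarrow> 'f::real_or_complex mv set \<Rightarrow> bool" where
  "ga_subalgebra p q r S \<longleftrightarrow>
     S \<subseteq> ga p q r \<and> mv.subspace S \<and> ga_one \<in> S \<and> (\<forall>U\<in>S. \<forall>V\<in>S. ga_mul p q r U V \<in> S)"

definition grassmann :: "nat \<Rightarrow> nat \<Rightarrow> nat \<Rightarrow> 'f::real_or_complex mv set" where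
  "grassmann p q r = \<Inter>{S. ga_subalgebra p q r S \<and> ga_gen ` {p+q+1..p+q+r} \<subseteq> S}"

definition grassmann_par :: "nat \<Rightarrow> nat \<Rightarrow> nat \<Rightarrow> nat \<Rightarrow> 'f::real_or_complex mv set" where
  "grassmann_par p q r k = grassmann p q r \<inter> ga_par p q r k"

definition ga_left_ideal :: "nat \<Rightarrow> nat \<Rightarrow> nat \<Rightarrow> 'f::real_or_complex mv set \<Rightarrow> bool" where
  "ga_left_ideal p q r I \<longleftrightarrow>
     I \<subseteq> ga p q r \<and> 0 \<in> I \<and> (\<forall>U\<in>I. \<forall>V\<in>I. U + V \<in> I) \<and>
     (\<forall>U\<in>ga p q r. \<forall>V\<in>I. ga_mul p q r U V \<in> I)"

definition ga_maximal_left_ideal :: "nat \<Rightarrow> nat \<Rightarrow> nat \<Rightarrow> 'f::real_or_complex mv set \<Rightarrow> bool" where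
  "ga_maximal_left_ideal p q r M \<longleftrightarrow>
     ga_left_ideal p q r M \<and> M \<noteq> ga p q r \<and>
     (\<forall>I. ga_left_ideal p q r I \<and> M \<subseteq> I \<longrightarrow> I = M \<or> I = ga p q r)"

text \<open>The Jacobson radical\<close>

definition ga_rad :: "nat \<Rightarrow> nat \<Rightarrow> nat \<Rightarrow> 'f::real_or_complex mv set" where
  "ga_rad p q r = {U \<in> ga p q r. \<forall>M. ga_maximal_left_ideal p q r M \<longrightarrow> U \<in> M}"

definition ga_rad_par :: "nat \<Rightarrow> nat \<Rightarrow> nat \<Rightarrow> nat \<Rightarrow> 'f::real_or_complex mv set" where
  "ga_rad_par p q r k = ga_rad p q r \<inter> ga_par p q r k"

definition ga_center :: "nat \<Rightarrow> nat \<Rightarrow> nat \<Rightarrow> 'f::real_or_complex mv set" where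
  "ga_center p q r = {U \<in> ga p q r. \<forall>V\<in>ga p q r. ga_mul p q r U V = ga_mul p q r V U}"

definition ga_is_inverse :: "nat \<Rightarrow> nat \<Rightarrow> nat \<Rightarrow> 'f::real_or_complex mv \<Rightarrow> 'f mv \<Rightarrow> bool" where
  "ga_is_inverse p q r U V \<longleftrightarrow>
     V \<in> ga p q r \<and> ga_mul p q r U V = ga_one \<and> ga_mul p q r V U = ga_one"

definition ga_inverse :: "nat \<Rightarrow> nat \<Rightarrow> nat \<Rightarrow> 'f::real_or_complex mv \<Rightarrow> 'f mv" where
  "ga_inverse p q r U = (THE V. ga_is_inverse p q r U V)"

text \<open>The elements of \<open>S\<close> that are invertible in the whole algebra (not necessarily in \<open>S\<close>)\<close>

definition ga_units :: "nat \<Rightarrow> nat \<Rightarrow> nat \<Rightarrow> 'f::real_or_complex mv set \<Rightarrow> 'f mv set" where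
  "ga_units p q r S = {U \<in> S. \<exists>V. ga_is_inverse p q r U V}"

definition ga_set_mul ::
  "nat \<Rightarrow> nat \<Rightarrow> nat \<Rightarrow> 'f::real_or_complex mv set \<Rightarrow> 'f mv set \<Rightarrow> 'f mv set" where
  "ga_set_mul p q r S T = {ga_mul p q r U V | U V. U \<in> S \<and> V \<in> T}"

definition mv_set_add :: "'f::real_or_complex mv set \<Rightarrow> 'f mv set \<Rightarrow> 'f mv set" where
  "mv_set_add S T = {U + V | U V. U \<in> S \<and> V \<in> T}"

text \<open>
  \<open>W\<close> is the internal direct sum of the listed subspaces: every element of \<open>W\<close> is, in exactly one
  way, a sum of one element from each of them, and all such sums lie in \<open>W\<close>.
\<close>

definition is_direct_sum :: "'f::real_or_complex mv set \<Rightarrow> 'f mv set list \<Rightarrow> bool" where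
  "is_direct_sum W Ws \<longleftrightarrow> bij_betw sum_list (listset Ws) W"


section \<open>The groups\<close>

definition grp_Ppm :: "nat \<Rightarrow> nat \<Rightarrow> nat \<Rightarrow> 'f::real_or_complex mv set" where
  "grp_Ppm p q r = ga_units p q r (ga_par p q r 0) \<union> ga_units p q r (ga_par p q r 1)"

definition grp_P :: "nat \<Rightarrow> nat \<Rightarrow> nat \<Rightarrow> 'f::real_or_complex mv set" where
  "grp_P p q r = ga_set_mul p q r (grp_Ppm p q r) (ga_units p q r (ga_center p q r))"

definition grp_PpmLambda :: "nat \<Rightarrow> nat \<Rightarrow> nat \<Rightarrow> 'f::real_or_complex mv set" where
  "grp_PpmLambda p q r = ga_set_mul p q r (grp_Ppm p q r) (ga_units p q r (grassmann p q r))"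

definition grp_PLambda :: "nat \<Rightarrow> nat \<Rightarrow> nat \<Rightarrow> 'f::real_or_complex mv set" where
  "grp_PLambda p q r = ga_set_mul p q r (grp_P p q r) (ga_units p q r (grassmann p q r))"

definition grp_Ppmrad :: "nat \<Rightarrow> nat \<Rightarrow> nat \<Rightarrow> 'f::real_or_complex mv set" where
  "grp_Ppmrad p q r =
     ga_set_mul p q r (grp_Ppm p q r)
       (ga_units p q r (mv_set_add (grade p q r 0) (ga_rad p q r)))"


section \<open>The Lie algebra of a group of multivectors\<close>

text \<open>
  \<open>\<gamma>\<close> is a curve that near \<open>0\<close> is smooth and stays in \<open>H\<close>, passes through the identity at time
  \<open>0\<close> and has velocity \<open>X\<close> there. Smoothness is taken coordinatewise: \<open>D k\<close> is the \<open>k\<close>-th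
  derivative. For complex scalars, too, the time parameter is real.
\<close>

definition smooth_curve_through_one ::
  "'f::real_or_complex mv set \<Rightarrow> (real \<Rightarrow> 'f mv) \<Rightarrow> 'f mv \<Rightarrow> bool" where
  "smooth_curve_through_one H \<gamma> X \<longleftrightarrow>
     \<gamma> 0 = ga_one \<and>
     (\<exists>\<epsilon>>0. (\<forall>t. \<bar>t\<bar> < \<epsilon> \<longrightarrow> \<gamma> t \<in> H) \<and>
        (\<exists>D. D 0 = \<gamma> \<and> D 1 0 = X \<and>
           (\<forall>k t A. \<bar>t\<bar> < \<epsilon> \<longrightarrow>
              ((\<lambda>s. D k s A) has_vector_derivative D (Suc k) t A) (at t))))"

text \<open>The Lie algebra of \<open>H\<close>, as a set, is the tangent space of \<open>H\<close> at the identity.\<close>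

definition lie_algebra :: "'f::real_or_complex mv set \<Rightarrow> 'f mv set" where
  "lie_algebra H = {X. \<exists>\<gamma>. smooth_curve_through_one H \<gamma> X}"

text \<open>
  \<open>Z\<close> is the Lie bracket of \<open>X\<close> and \<open>Y\<close>, that is, the derivative at the identity of the adjoint
  action on \<open>Y\<close> in the direction \<open>X\<close>.
\<close>

definition is_lie_bracket ::
  "nat \<Rightarrow> nat \<Rightarrow> nat \<Rightarrow> 'f::real_or_complex mv set \<Rightarrow> 'f mv \<Rightarrow> 'f mv \<Rightarrow> 'f mv \<Rightarrow> bool" where
  "is_lie_bracket p q r H X Y Z \<longleftrightarrow>
     (\<forall>\<gamma>. smooth_curve_through_one H \<gamma> X \<longrightarrow>
        (\<forall>A. ((\<lambda>t. ga_mul p q r (ga_mul p q r (\<gamma> t) Y) (ga_inverse p q r (\<gamma> t)) A)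
               has_vector_derivative Z A) (at 0)))"

definition ga_commutator :: "nat \<Rightarrow> nat \<Rightarrow> nat \<Rightarrow> 'f::real_or_complex mv \<Rightarrow> 'f mv \<Rightarrow> 'f mv" where
  "ga_commutator p q r U V = ga_mul p q r U V - ga_mul p q r V U"

end

theory Submission
  imports Defs
begin

text \<open>
  Each group \<open>H\<close> lies in a product \<open>P\<^sup>\<plusminus> S\<^sup>\<times>\<close> for a subalgebra \<open>S\<close> spanned by basis elements. An element
  \<open>T = U V\<close> with \<open>U\<close> homogeneous and \<open>V \<in> S\<^sup>\<times>\<close> satisfies \<open>grade_inv T = T W\<close> with
  \<open>W = \<plusminus> V\<^sup>-\<^sup>1 (grade_inv V) \<in> S\<close>; differentiating along a curve through the identity shows that the odd
  part of the velocity lies in \<open>S\<close>. Conversely, if \<open>X\<close> is even and \<open>Y\<close>, \<open>Z\<close> lie in the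
  subalgebras whose units occur as factors of \<open>H\<close>, then the curve \<open>(1 + t X) (1 + t Y) (1 + t Z)\<close>
  stays in \<open>H\<close> for small \<open>t\<close> and has velocity \<open>X + Y + Z\<close>. So every Lie algebra is spanned by basis
  elements, and the decompositions and dimensions are found by counting. That the Jacobson radical
  is spanned by the basis elements with a null index is Maschke's theorem for the nondegenerate part
  together with the nilpotency of the ideal generated by the null generators.
\<close>

section \<open>Coordinate subspaces\<close>

text \<open>Tangent vectors are defined by arbitrary smooth curves, and the groups are not known to
  be closed, so the upper bound has to come from a relation that holds at each point separately.
  Only the membership of W in a coordinate subspace is kept, and this passes to limits however W
  depends on the point. The sign given by the parity of U is absorbed into W, so the two components
  of \<open>grp_Ppm\<close> are treated together.

  Even velocities are always available, hence a factor of a group matters only through its odd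
  elements. The center therefore enters through an upper bound and, for odd n, the top blade. The
  radical is needed exactly, and its definition by maximal left ideals is what calls for Maschke's
  argument. Families of index sets encode the subspaces: sum and dimension become union and
  cardinality, and products become symmetric differences of sets without a common null
  index.\<close>

definition supported_on :: "nat set set \<Rightarrow> 'f::real_or_complex mv set" where
  "supported_on G = {U. \<forall>A. A \<notin> G \<longrightarrow> U A = 0}"

lemma subspace_supported_on: "mv.subspace (supported_on G)"
  by (auto simp: mv.subspace_def supported_on_def mv_scale_def)

lemma supported_on_mono: "G \<subseteq> H \<Longrightarrow> supported_on G \<subseteq> supported_on H"
  by (auto simp: supported_on_def)

lemma ga_eq_supported_on: "ga p q r = supported_on (Pow {1..p+q+r})"
  by (auto simp: ga_def supported_on_def)

lemma blade_in_supported_on: "A \<in> G \<Longrightarrow> blade A \<in> supported_on G"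
  by (auto simp: blade_def supported_on_def)

lemma inj_blade: "inj (blade :: nat set \<Rightarrow> 'f::real_or_complex mv)"
  by (rule injI) (metis blade_def zero_neq_one)

lemma span_blade_image:
  assumes "finite G"
  shows "mv.span (blade ` G) = (supported_on G :: 'f::real_or_complex mv set)"
proof (rule mv.span_subspace)
  show "supported_on G \<subseteq> mv.span (blade ` G :: 'f mv set)"
  proof
    fix U :: "'f mv" assume "U \<in> supported_on G"
    then have "U = (\<Sum>A\<in>G. mv_scale (U A) (blade A))"
      using assms
      by (intro ext) (auto simp: mv_sum_apply mv_scale_def blade_def supported_on_def if_distrib cong: if_cong)
    also have "\<dots> \<in> mv.span (blade ` G)"
      by (intro mv.span_sum mv.span_scale mv.span_base) auto
    finally show "U \<in> mv.span (blade ` G)" .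
  qed
qed (auto intro: blade_in_supported_on subspace_supported_on)

lemma dim_supported_on:
  assumes "G \<subseteq> Pow {1..n}"
  shows "mv.dim (supported_on G :: 'f::real_or_complex mv set) = card G"
proof -
  have "mv.independent (blade ` G :: 'f mv set)"
    by (rule mv.independent_mono[OF ga_basis(1)[of n 0 0]]) (use assms in auto)
  then have "mv.dim (mv.span (blade ` G :: 'f mv set)) = card (blade ` G :: 'f mv set)"
    by (rule mv.dim_span_eq_card_independent)
  then show ?thesis
    using finite_subset[OF assms]
    by (simp add: span_blade_image card_image inj_on_subset[OF inj_blade])
qed

section \<open>Direct sums of coordinate subspaces and parity counts\<close>

lemma is_direct_sum_single: "is_direct_sum W [W]"
  by (auto simp: is_direct_sum_def bij_betw_def inj_on_def image_image)

text \<open>At an index in \<open>G\<close> every sum over the tail vanishes, since it lies in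
  \<open>supported_on H\<close>. So the head can be read off coordinatewise, and injectivity on the
  tail does the rest.\<close>

lemma is_direct_sum_Cons:
  assumes Ws: "is_direct_sum (supported_on H) Ws" and disj: "G \<inter> H = {}"
  shows "is_direct_sum (supported_on (G \<union> H) :: 'f::real_or_complex mv set) (supported_on G # Ws)"
proof -
  have inj: "inj_on sum_list (listset Ws)" and img: "sum_list ` listset Ws = supported_on H"
    using Ws by (auto simp: is_direct_sum_def bij_betw_def)
  have "inj_on sum_list (listset (supported_on G # Ws))"
  proof (rule inj_onI)
    fix us vs :: "'f mv list"
    assume "us \<in> listset (supported_on G # Ws)" "vs \<in> listset (supported_on G # Ws)"
      and eq: "sum_list us = sum_list vs"
    then obtain u us' v vs' where us: "us = u # us'" "vs = v # vs'"
      and in1: "u \<in> supported_on G" "v \<in> supported_on G" and in2: "us' \<in> listset Ws" "vs' \<in> listset Ws"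
      by (auto simp: set_Cons_def)
    have H: "sum_list us' \<in> supported_on H" "sum_list vs' \<in> supported_on H"
      using in2 img by auto
    have "u A = v A" for A
    proof (cases "A \<in> G")
      case True
      then have "sum_list us' A = 0" "sum_list vs' A = 0"
        using H disj by (auto simp: supported_on_def)
      then show ?thesis using fun_cong[OF eq, of A] us by simp
    qed (use in1 in \<open>auto simp: supported_on_def\<close>)
    then have "u = v" by auto
    moreover from this have "sum_list us' = sum_list vs'" using eq us by simp
    ultimately show "us = vs" using us inj_onD[OF inj _ in2] by simp
  qed
  moreover have "sum_list ` listset (supported_on G # Ws) = supported_on (G \<union> H)"
  proof (intro equalityI subsetI)
    fix X :: "'f mv" assume "X \<in> sum_list ` listset (supported_on G # Ws)"
    then obtain u us where "X = u + sum_list us" "u \<in> supported_on G" "us \<in> listset Ws"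
      by (auto simp: set_Cons_def)
    moreover from this have "sum_list us \<in> supported_on H" using img by auto
    ultimately show "X \<in> supported_on (G \<union> H)" by (auto simp: supported_on_def)
  next
    fix X :: "'f mv" assume X: "X \<in> supported_on (G \<union> H)"
    define u where "u = (\<lambda>A. if A \<in> G then X A else 0)"
    have u: "u \<in> supported_on G" by (auto simp: u_def supported_on_def)
    have "X - u \<in> supported_on H" using X by (auto simp: u_def supported_on_def)
    then obtain us where us: "us \<in> listset Ws" "sum_list us = X - u" using img by (metis imageE)
    then have "sum_list (u # us) = X" by simp
    then show "X \<in> sum_list ` listset (supported_on G # Ws)"
      using u us by (intro image_eqI[of _ _ "u # us"]) (auto simp: set_Cons_def)
  qed
  ultimately show ?thesis by (simp add: is_direct_sum_def bij_betw_def)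
qed

text \<open>Toggling one fixed element of \<open>N\<close> is an involution that exchanges even and
  odd subsets, so each kind makes up half of the power set.\<close>

lemma card_even_odd_subsets:
  assumes "finite N" "N \<noteq> {}"
  shows "card {A. A \<subseteq> N \<and> even (card A)} = 2 ^ (card N - 1)"
    and "card {A. A \<subseteq> N \<and> odd (card A)} = 2 ^ (card N - 1)"
proof -
  obtain a where a: "a \<in> N" using assms by auto
  let ?E = "{A. A \<subseteq> N \<and> even (card A)}" and ?O = "{A. A \<subseteq> N \<and> odd (card A)}"
  have fin: "finite A" if "A \<subseteq> N" for A using that assms by (metis finite_subset)
  have *: "even (card (sym_diff A {a})) \<longleftrightarrow> odd (card A)" if "A \<subseteq> N" for A
    using fin[OF that] by (cases "a \<in> A") (auto simp: card_Diff_singleton card_gt_0_iff insert_Diff_if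
      intro: ccontr dest: card_gt_0_iff[THEN iffD2])
  have "bij_betw (\<lambda>A. sym_diff A {a}) ?E ?O"
    by (rule bij_betw_byWitness[where f' = "\<lambda>A. sym_diff A {a}"]) (use * a in auto)
  then have eq: "card ?E = card ?O" by (rule bij_betw_same_card)
  have "card ?E + card ?O = card (?E \<union> ?O)"
    using assms by (intro card_Un_disjoint[symmetric]) auto
  also have "?E \<union> ?O = Pow N" by auto
  finally have "2 * card ?E = 2 ^ card N" using assms eq by (simp add: card_Pow)
  moreover have "card N > 0" using assms by (simp add: card_gt_0_iff)
  ultimately show "card ?E = 2 ^ (card N - 1)" by (cases "card N") auto
  with eq show "card ?O = 2 ^ (card N - 1)" by simp
qed

lemma even_card_sym_diff:
  assumes "finite A" "finite B"
  shows "even (card (sym_diff A B)) \<longleftrightarrow> (even (card A) \<longleftrightarrow> even (card B))"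
proof -
  have "card (sym_diff A B) + 2 * card (A \<inter> B) = card A + card B"
    using assms card_Un_disjoint[of "A - B" "B - A"] card_Int_Diff[of A B] card_Int_Diff[of B A]
    by (auto simp: Int_commute)
  then show ?thesis by presburger
qed

section \<open>Structure constants\<close>

text \<open>The coefficient is a sign times the squares of the shared generators. For subsets of
  \<open>{1..p+q+r}\<close> the right side therefore says that \<open>A\<close> and \<open>B\<close>
  share a null index.\<close>

lemma ga_coef_eq_0_iff:
  assumes "finite A"
  shows "(ga_coef p q r A B :: 'f::real_or_complex) = 0 \<longleftrightarrow> \<not> A \<inter> B \<subseteq> {..p+q}"
  using assms by (auto simp: ga_coef_def ga_eta_def subset_iff)

text \<open>A pair in \<open>A \<times> B\<close> with distinct entries is out of order for exactly
  one of the two products, and there are \<open>card A * card B - card (A \<inter> B)\<close> such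
  pairs. Addition replaces subtraction because only the parity counts.\<close>

lemma ga_coef_swap:
  assumes "finite A" "finite B"
  shows "ga_coef p q r A B =
    (-1) ^ (card A * card B + card (A \<inter> B)) * (ga_coef p q r B A :: 'f::real_or_complex)"
proof -
  define L where "L A B = {(a, b). a \<in> A \<and> b \<in> B \<and> b < a}" for A B :: "nat set"
  have fin: "finite (L A B)" if "finite A" "finite B" for A B
    by (rule finite_subset[of _ "A \<times> B"]) (use that in \<open>auto simp: L_def\<close>)
  have "A \<times> B = L A B \<union> (prod.swap ` L B A \<union> (\<lambda>a. (a, a)) ` (A \<inter> B))"
    by (auto simp: L_def image_iff)
  then have "card (A \<times> B) = card (L A B \<union> (prod.swap ` L B A \<union> (\<lambda>a. (a, a)) ` (A \<inter> B)))"
    by simp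
  also have "\<dots> = card (L A B) + card (prod.swap ` L B A \<union> (\<lambda>a. (a, a)) ` (A \<inter> B))"
    using fin assms by (intro card_Un_disjoint) (auto simp: L_def)
  also have "card (prod.swap ` L B A \<union> (\<lambda>a. (a, a)) ` (A \<inter> B)) =
      card (prod.swap ` L B A) + card ((\<lambda>a. (a, a)) ` (A \<inter> B))"
    using fin assms by (intro card_Un_disjoint) (auto simp: L_def)
  also have "card (prod.swap ` L B A) = card (L B A)"
    by (rule card_image) (auto simp: inj_on_def)
  finally have "card A * card B = card (L A B) + (card (L B A) + card (A \<inter> B))"
    by (simp add: card_cartesian_product card_image inj_on_def)
  then have "card A * card B + card (A \<inter> B) + card (L B A) =
      card (L A B) + 2 * (card (A \<inter> B) + card (L B A))" by simp
  then have "(-1) ^ (card A * card B + card (A \<inter> B)) * (-1) ^ card (L B A) = ((-1) ^ card (L A B) :: 'f)"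
    by (simp only: flip: power_add) (simp add: power_add power_mult)
  then show ?thesis
    by (simp add: ga_coef_def L_def Int_commute[of B A] flip: mult.assoc)
qed

lemma norm_ga_coef_le_1: "norm (ga_coef p q r A B :: 'f::real_or_complex) \<le> 1"
proof -
  have "norm (\<Prod>a\<in>A \<inter> B. ga_eta p q r a :: 'f) \<le> 1"
    unfolding prod_norm[symmetric] by (rule prod_le_1) (auto simp: ga_eta_def)
  then show ?thesis by (simp add: ga_coef_def norm_mult norm_power)
qed

lemma ga_mul_nth:
  fixes U V :: "'f::real_or_complex mv"
  assumes "C \<subseteq> {1..p+q+r}"
  shows "ga_mul p q r U V C =
    (\<Sum>A\<in>Pow {1..p+q+r}. U A * V (sym_diff A C) * ga_coef p q r A (sym_diff A C))"
  unfolding ga_mul_apply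
proof (rule sum.cong[OF refl])
  fix A assume "A \<in> Pow {1..p+q+r}"
  have "(if C = sym_diff A B then U A * V B * ga_coef p q r A B else 0) =
      (if B = sym_diff A C then U A * V B * ga_coef p q r A B else 0)" for B
    by (rule if_cong) auto
  then show "(\<Sum>B\<in>Pow {1..p+q+r}. if C = sym_diff A B then U A * V B * ga_coef p q r A B else 0) =
    U A * V (sym_diff A C) * ga_coef p q r A (sym_diff A C)"
    using \<open>A \<in> _\<close> assms by (simp add: sum.delta) blast
qed

text \<open>Only pairs with a nonzero structure constant contribute, so closure has to be checked
  just for index sets without a common null index. The subalgebra and ideal properties below reduce
  to this condition.\<close>

lemma ga_mul_in_supported_on:
  fixes U V :: "'f::real_or_complex mv"
  assumes "U \<in> supported_on G" "V \<in> supported_on H"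
    and "\<And>A B. A \<in> G \<Longrightarrow> B \<in> H \<Longrightarrow> A \<subseteq> {1..p+q+r} \<Longrightarrow> B \<subseteq> {1..p+q+r} \<Longrightarrow>
      A \<inter> B \<subseteq> {..p+q} \<Longrightarrow> sym_diff A B \<in> K"
  shows "ga_mul p q r U V \<in> supported_on K"
  unfolding supported_on_def
proof (intro CollectI allI impI)
  fix C assume "C \<notin> K"
  have "U A * V B * ga_coef p q r A B = 0"
    if "A \<subseteq> {1..p+q+r}" "B \<subseteq> {1..p+q+r}" "C = sym_diff A B" for A B
  proof (rule ccontr)
    assume ne: "U A * V B * ga_coef p q r A B \<noteq> 0"
    then have "A \<in> G" "B \<in> H" using assms by (auto simp: supported_on_def)
    moreover have "A \<inter> B \<subseteq> {..p+q}"
      using ne ga_coef_eq_0_iff[of A p q r B, where 'f='f] finite_subset[OF that(1)] by auto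
    ultimately show False using assms(3) that \<open>C \<notin> K\<close> by metis
  qed
  then show "ga_mul p q r U V C = 0"
    unfolding ga_mul_apply by (intro sum.neutral ballI) auto
qed

lemma ga_mul_diff_left: "ga_mul p q r (U - U') V = ga_mul p q r U V - ga_mul p q r U' V"
  using ga_mul_add_left[of p q r "U - U'" U' V] by (simp add: algebra_simps)

lemma ga_mul_diff_right: "ga_mul p q r U (V - V') = ga_mul p q r U V - ga_mul p q r U V'"
  using ga_mul_add_right[of p q r U "V - V'" V'] by (simp add: algebra_simps)

global_interpretation mv_pair: vector_space_pair mv_scale mv_scale
  by unfold_locales

lemma linear_ga_mul_left: "Vector_Spaces.linear mv_scale mv_scale (ga_mul p q r U)"
  by (simp add: Vector_Spaces.linear_iff mv.vector_space_axioms ga_mul_add_right ga_mul_scale_right)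

text \<open>The type of multivectors is infinite-dimensional, so finiteness comes from
  \<open>W \<subseteq> ga p q r\<close>. The image of a basis \<open>B\<close> of \<open>W\<close>
  is independent and as large as \<open>B\<close>; an element of \<open>W\<close> outside its span
  would give an independent set larger than the spanning set \<open>B\<close>.\<close>

lemma injective_endomorphism_surjective:
  fixes W :: "'f::real_or_complex mv set"
  assumes W: "mv.subspace W" "W \<subseteq> ga p q r"
    and f: "Vector_Spaces.linear mv_scale mv_scale f" "f ` W \<subseteq> W"
    and inj: "\<And>U. U \<in> W \<Longrightarrow> f U = 0 \<Longrightarrow> U = 0"
  shows "f ` W = W"
proof -
  interpret f: Vector_Spaces.linear mv_scale mv_scale f by fact
  obtain B where B: "B \<subseteq> W" "mv.independent B" "W \<subseteq> mv.span B"
    by (rule mv.basis_exists)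
  have "B \<subseteq> mv.span (blade ` Pow {1..p+q+r})" using B(1) W(2) unfolding ga_basis(2) by (rule subset_trans)
  then have finB: "finite B"
    using mv.independent_span_bound[OF _ B(2)] by (metis finite_Pow_iff finite_atLeastAtMost finite_imageI)
  have span: "mv.span B = W" by (rule mv.span_subspace[OF B(1,3) W(1)])
  have "inj_on f W"
    using W(1) inj by (intro inj_onI) (metis f.diff mv.subspace_diff right_minus_eq)
  then have ind: "mv.independent (f ` B)" and card: "card (f ` B) = card B"
    using mv_pair.linear_independent_injective_image[OF f(1) B(2)] span
    by (auto simp: card_image inj_on_subset[OF _ B(1)])
  have "W \<subseteq> f ` W"
  proof
    fix x assume x: "x \<in> W"
    have "x \<in> mv.span (f ` B)"
    proof (rule ccontr)
      assume nx: "x \<notin> mv.span (f ` B)"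
      then have "mv.independent (insert x (f ` B))" using ind by (rule mv.independent_insertI)
      moreover have "insert x (f ` B) \<subseteq> mv.span B" using x span f(2) B(1) by auto
      ultimately have "card (insert x (f ` B)) \<le> card B"
        using mv.independent_span_bound[OF finB] by metis
      moreover have "x \<notin> f ` B" using nx mv.span_base[of x "f ` B"] by metis
      ultimately show False using card finB by simp
    qed
    then show "x \<in> f ` W" using f.span_image[of B] span by auto
  qed
  then show ?thesis using f(2) by blast
qed

section \<open>Inverses, norms and curves\<close>

lemma has_vector_derivative_iff_quotient:
  fixes f :: "real \<Rightarrow> 'a::real_normed_vector"
  shows "(f has_vector_derivative D) (at 0) \<longleftrightarrow> ((\<lambda>t. (1 / t) *\<^sub>R (f t - f 0)) \<longlongrightarrow> D) (at 0)"
proof -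
  have "(f has_vector_derivative D) (at 0) \<longleftrightarrow>
      ((\<lambda>t. norm ((f t - f 0) - t *\<^sub>R D) / norm t) \<longlongrightarrow> 0) (at 0)"
    by (simp add: has_vector_derivative_def has_derivative_iff_norm bounded_linear_scaleR_left)
  also have "\<dots> \<longleftrightarrow> ((\<lambda>t. norm ((1 / t) *\<^sub>R (f t - f 0) - D)) \<longlongrightarrow> 0) (at 0)"
  proof (rule filterlim_cong[OF refl refl])
    show "\<forall>\<^sub>F t in at 0. norm ((f t - f 0) - t *\<^sub>R D) / norm t = norm ((1 / t) *\<^sub>R (f t - f 0) - D)"
      unfolding eventually_at_filter
    proof (intro always_eventually allI impI)
      fix t :: real assume "t \<noteq> 0"
      then have "(1 / t) *\<^sub>R (f t - f 0) - D = (1 / t) *\<^sub>R ((f t - f 0) - t *\<^sub>R D)"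
        by (simp add: algebra_simps)
      then show "norm ((f t - f 0) - t *\<^sub>R D) / norm t = norm ((1 / t) *\<^sub>R (f t - f 0) - D)"
        by simp
    qed
  qed
  also have "\<dots> \<longleftrightarrow> ((\<lambda>t. (1 / t) *\<^sub>R (f t - f 0)) \<longlongrightarrow> D) (at 0)"
    by (simp add: tendsto_norm_zero_iff LIM_zero_iff)
  finally show ?thesis .
qed

locale geometric_algebra =
  fixes p q r :: nat
begin

abbreviation idx :: "nat set" where "idx \<equiv> {1..p+q+r}"
abbreviation alg :: "'f::real_or_complex mv set" where "alg \<equiv> ga p q r"
abbreviation mul :: "'f::real_or_complex mv \<Rightarrow> 'f mv \<Rightarrow> 'f mv" (infixl "\<odot>" 70)
  where "U \<odot> V \<equiv> ga_mul p q r U V"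
abbreviation is_inv :: "'f::real_or_complex mv \<Rightarrow> 'f mv \<Rightarrow> bool"
  where "is_inv \<equiv> ga_is_inverse p q r"
abbreviation units :: "'f::real_or_complex mv set \<Rightarrow> 'f mv set"
  where "units \<equiv> ga_units p q r"
abbreviation subalgebra :: "'f::real_or_complex mv set \<Rightarrow> bool"
  where "subalgebra \<equiv> ga_subalgebra p q r"

lemma one_in_alg [simp]: "ga_one \<in> alg"
  by (simp add: blade_in_ga)

lemma mul_in_alg [simp]: "U \<odot> V \<in> alg"
  by (rule ga_mul_closed)

lemma add_in_alg [simp]: "U \<in> alg \<Longrightarrow> V \<in> alg \<Longrightarrow> U + V \<in> alg"
  and diff_in_alg [simp]: "U \<in> alg \<Longrightarrow> V \<in> alg \<Longrightarrow> U - V \<in> alg"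
  and scale_in_alg [simp]: "U \<in> alg \<Longrightarrow> mv_scale c U \<in> alg"
  and zero_in_alg [simp]: "0 \<in> alg"
  using ga_subspace by (blast intro: mv.subspace_add mv.subspace_diff mv.subspace_scale mv.subspace_0)+

lemma mul_assoc: "U \<in> alg \<Longrightarrow> V \<in> alg \<Longrightarrow> W \<in> alg \<Longrightarrow> U \<odot> V \<odot> W = U \<odot> (V \<odot> W)"
  by (rule ga_mul_assoc)

lemmas mul_one [simp] = ga_mul_one[of _ p q r]

lemma finite_idx_subset: "A \<subseteq> idx \<Longrightarrow> finite A"
  by (rule finite_subset) auto

lemma subalgebra_alg: "subalgebra alg"
  by (auto simp: ga_subalgebra_def ga_subspace)

section \<open>Inverses in finite-dimensional subalgebras\<close>

lemma inverse_unique: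
  assumes "U \<in> alg" "is_inv U V" "is_inv U V'"
  shows "V = V'"
  using assms mul_assoc[of V U V'] by (simp add: ga_is_inverse_def)

lemma ga_inverse_is_inverse:
  assumes "U \<in> units S" "S \<subseteq> alg"
  shows "is_inv U (ga_inverse p q r U)"
proof -
  obtain V where V: "is_inv U V" and U: "U \<in> alg" using assms by (auto simp: ga_units_def)
  show ?thesis
    unfolding ga_inverse_def by (rule theI[of "is_inv U", OF V]) (rule inverse_unique[OF U _ V])
qed

text \<open>Left multiplication by \<open>U\<close> is an injective endomorphism of the
  finite-dimensional \<open>S\<close>, hence reaches the identity:
  \<open>U \<odot> V = ga_one\<close> with \<open>V\<close> in \<open>S\<close>. Then
  \<open>U \<odot> (V \<odot> U - ga_one) = 0\<close>, and injectivity makes \<open>V\<close> a left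
  inverse as well.\<close>

lemma injective_imp_inverse:
  assumes S: "subalgebra S" and U: "U \<in> S"
    and inj: "\<And>V. V \<in> alg \<Longrightarrow> U \<odot> V = 0 \<Longrightarrow> V = 0"
  shows "\<exists>V\<in>S. is_inv U V"
proof -
  have S': "S \<subseteq> alg" "mv.subspace S" "ga_one \<in> S" "\<And>V. V \<in> S \<Longrightarrow> U \<odot> V \<in> S"
    using S U by (auto simp: ga_subalgebra_def)
  have "(\<odot>) U ` S = S"
    by (rule injective_endomorphism_surjective[OF S'(2,1) linear_ga_mul_left]) (use S' inj in auto)
  then obtain V where V: "V \<in> S" "U \<odot> V = ga_one" using S'(3) by (metis imageE)
  have alg: "U \<in> alg" "V \<in> alg" using S'(1) U V by auto
  have "U \<odot> (V \<odot> U - ga_one) = 0"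
    using alg V by (simp add: ga_mul_diff_right flip: mul_assoc)
  then have "V \<odot> U = ga_one" using inj[of "V \<odot> U - ga_one"] by simp
  then show ?thesis using V alg by (auto simp: ga_is_inverse_def)
qed

text \<open>\<open>ga_units\<close> only asks for an inverse in the whole algebra. Such a unit has
  injective left multiplication, so by finite dimension its inverse lies in every subalgebra
  containing it.\<close>

lemma inverse_in_subalgebra:
  assumes S: "subalgebra S" and U: "U \<in> S" and V: "is_inv U V"
  shows "V \<in> S"
proof -
  have U': "U \<in> alg" using S U by (auto simp: ga_subalgebra_def)
  have "W = 0" if "W \<in> alg" "U \<odot> W = 0" for W
    using V U' that mul_assoc[of V U W] by (simp add: ga_is_inverse_def ga_mul_zero_right)
  then obtain V' where "V' \<in> S" "is_inv U V'" using injective_imp_inverse[OF S U] by blast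
  then show ?thesis using inverse_unique[OF U' V] by simp
qed

lemma is_inverse_mul:
  assumes "U \<in> alg" "V \<in> alg" "is_inv U U'" "is_inv V V'"
  shows "is_inv (U \<odot> V) (V' \<odot> U')"
proof -
  have *: "U' \<in> alg" "V' \<in> alg" "U \<odot> U' = ga_one" "U' \<odot> U = ga_one" "V \<odot> V' = ga_one" "V' \<odot> V = ga_one"
    using assms by (auto simp: ga_is_inverse_def)
  have "(U \<odot> V) \<odot> (V' \<odot> U') = U \<odot> ((V \<odot> V') \<odot> U')" "(V' \<odot> U') \<odot> (U \<odot> V) = V' \<odot> ((U' \<odot> U) \<odot> V)"
    using assms(1,2) *(1,2) by (simp_all add: mul_assoc)
  then show ?thesis using * assms(1,2) by (simp add: ga_is_inverse_def)
qed

section \<open>A submultiplicative norm and invertibility near the identity\<close>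

definition mv_norm :: "'f::real_or_complex mv \<Rightarrow> real" where
  "mv_norm U = (\<Sum>A\<in>Pow idx. norm (U A))"

lemma mv_norm_nonneg [simp]: "mv_norm U \<ge> 0"
  by (simp add: mv_norm_def sum_nonneg)

lemma norm_le_mv_norm:
  assumes "U \<in> alg"
  shows "norm (U A) \<le> mv_norm U"
proof (cases "A \<subseteq> idx")
  case True
  then show ?thesis unfolding mv_norm_def by (intro member_le_sum) auto
next
  case False
  then have "U A = 0" using assms by (simp add: ga_def)
  then show ?thesis by simp
qed

lemma mv_norm_eq_0D:
  assumes "U \<in> alg" "mv_norm U \<le> 0"
  shows "U = 0"
proof
  fix A
  have "norm (U A) \<le> 0" using norm_le_mv_norm[OF assms(1), of A] assms(2) by linarith
  then show "U A = 0 A" by simp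
qed

lemma mv_norm_add: "mv_norm (U + V) \<le> mv_norm U + mv_norm V"
  unfolding mv_norm_def sum.distrib[symmetric] by (intro sum_mono) (simp add: norm_triangle_ineq)

lemma mv_norm_scale: "mv_norm (mv_scale c U) = norm c * mv_norm U"
  by (simp add: mv_norm_def mv_scale_def norm_mult sum_distrib_left)

lemma mv_norm_one: "mv_norm (ga_one :: 'f::real_or_complex mv) = 1"
proof -
  have "mv_norm (ga_one :: 'f mv) = (\<Sum>A\<in>Pow idx. if A = {} then 1 else 0)"
    unfolding mv_norm_def by (intro sum.cong refl) (simp add: blade_def)
  then show ?thesis by (simp add: sum.delta)
qed

text \<open>The sum norm suits the product because each pair \<open>(A, B)\<close> contributes to a
  single coordinate \<open>C\<close>, with a structure constant of modulus at most \<open>1\<close>;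
  after exchanging the sums, the one over \<open>C\<close> collapses.\<close>

lemma mv_norm_mul: "mv_norm (U \<odot> V) \<le> mv_norm U * mv_norm (V :: 'f::real_or_complex mv)"
proof -
  let ?P = "Pow idx"
  have "norm ((U \<odot> V) C) \<le> (\<Sum>A\<in>?P. \<Sum>B\<in>?P. if C = sym_diff A B then norm (U A) * norm (V B) else 0)" for C
    unfolding ga_mul_apply
  proof (intro sum_norm_le)
    fix A B
    have "norm (U A * V B * ga_coef p q r A B) \<le> norm (U A) * norm (V B) * 1"
      unfolding norm_mult by (intro mult_left_mono norm_ga_coef_le_1) simp
    then show "norm (if C = sym_diff A B then U A * V B * ga_coef p q r A B else 0)
        \<le> (if C = sym_diff A B then norm (U A) * norm (V B) else 0)" by simp
  qed
  then have "mv_norm (U \<odot> V) \<le>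
      (\<Sum>C\<in>?P. \<Sum>A\<in>?P. \<Sum>B\<in>?P. if C = sym_diff A B then norm (U A) * norm (V B) else 0)"
    unfolding mv_norm_def by (intro sum_mono)
  also have "\<dots> = (\<Sum>A\<in>?P. \<Sum>C\<in>?P. \<Sum>B\<in>?P. if C = sym_diff A B then norm (U A) * norm (V B) else 0)"
    by (rule sum.swap)
  also have "\<dots> = (\<Sum>A\<in>?P. \<Sum>B\<in>?P. \<Sum>C\<in>?P. if C = sym_diff A B then norm (U A) * norm (V B) else 0)"
    by (intro sum.cong[OF refl] sum.swap)
  also have "\<dots> = (\<Sum>A\<in>?P. \<Sum>B\<in>?P. norm (U A) * norm (V B))"
    by (intro sum.cong refl, subst sum.delta) auto
  also have "\<dots> = mv_norm U * mv_norm V"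
    by (simp add: mv_norm_def sum_product)
  finally show ?thesis .
qed

text \<open>If the product with \<open>V\<close> is zero, then
  \<open>V = mv_scale (- c) (X \<odot> V)\<close>, so
  \<open>mv_norm V \<le> norm c * mv_norm X * mv_norm V\<close> and \<open>V = 0\<close>. In finite
  dimension this injectivity takes the place of a Neumann series.\<close>

lemma inverse_one_plus_small:
  fixes X :: "'f::real_or_complex mv"
  assumes X: "X \<in> alg" and t: "norm c * mv_norm X < 1"
  shows "\<exists>V. is_inv (ga_one + mv_scale c X) V"
proof -
  have "V = 0" if V: "V \<in> alg" "(ga_one + mv_scale c X) \<odot> V = 0" for V
  proof (rule mv_norm_eq_0D[OF V(1)], rule ccontr)
    assume pos: "\<not> mv_norm V \<le> 0"
    have "V + mv_scale c (X \<odot> V) = 0"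
      using V by (simp add: ga_mul_add_left ga_mul_scale_left)
    then have "V = mv_scale (- c) (X \<odot> V)"
      unfolding mv.scale_minus_left by (rule eq_neg_iff_add_eq_0[THEN iffD2])
    then have "mv_norm V = norm c * mv_norm (X \<odot> V)"
      using mv_norm_scale[of "- c" "X \<odot> V"] by simp
    also have "\<dots> \<le> norm c * (mv_norm X * mv_norm V)"
      by (intro mult_left_mono mv_norm_mul) simp
    also have "\<dots> < 1 * mv_norm V"
      using t pos by (simp only: mult.assoc[symmetric]) (intro mult_strict_right_mono, auto)
    finally show False by simp
  qed
  then have "\<exists>V\<in>alg. is_inv (ga_one + mv_scale c X) V"
    by (intro injective_imp_inverse subalgebra_alg) (use X in simp_all)
  then show ?thesis by blast
qed

text \<open>From \<open>R \<odot> U = ga_one\<close> it follows that R - 1 = - R (U - 1). With d and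
  n the norms of U - 1 and R - 1 this gives n \<le> (n + 1) d; as d is at most 1/2, the term n d can
  be absorbed on the left at the cost of the factor 2.\<close>

lemma mv_norm_inverse_minus_one:
  assumes U: "U \<in> alg" and R: "is_inv U R" and small: "mv_norm (U - ga_one) \<le> 1 / 2"
  shows "mv_norm (R - ga_one) \<le> 2 * mv_norm (U - ga_one)"
proof -
  have R': "R \<in> alg" "R \<odot> U = ga_one" using R by (auto simp: ga_is_inverse_def)
  let ?d = "mv_norm (U - ga_one)" and ?n = "mv_norm (R - ga_one)"
  have "R - ga_one = mv_scale (- 1) (R \<odot> (U - ga_one))"
    using R' by (simp add: ga_mul_diff_right)
  then have "?n = mv_norm (R \<odot> (U - ga_one))"
    using mv_norm_scale[of "- 1" "R \<odot> (U - ga_one)"] by simp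
  also have "\<dots> \<le> mv_norm R * ?d" by (rule mv_norm_mul)
  also have "\<dots> \<le> (?n + 1) * ?d"
    using mv_norm_add[of "R - ga_one" ga_one] by (intro mult_right_mono) (auto simp: mv_norm_one)
  also have "\<dots> = ?n * ?d + ?d" by (simp add: algebra_simps)
  also have "\<dots> \<le> ?n * (1 / 2) + ?d" using small by (intro add_right_mono mult_left_mono) auto
  finally show ?thesis by simp
qed

section \<open>Coordinatewise limits and velocities of curves\<close>

definition coord_tendsto :: "('a \<Rightarrow> 'f::real_or_complex mv) \<Rightarrow> 'f mv \<Rightarrow> 'a filter \<Rightarrow> bool" where
  "coord_tendsto f L F \<longleftrightarrow> (\<forall>A. ((\<lambda>t. f t A) \<longlongrightarrow> L A) F)"

lemma coord_tendsto_const: "coord_tendsto (\<lambda>_. U) U F"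
  by (simp add: coord_tendsto_def)

lemma coord_tendsto_diff:
  "coord_tendsto f L F \<Longrightarrow> coord_tendsto g M F \<Longrightarrow> coord_tendsto (\<lambda>t. f t - g t) (L - M) F"
  by (auto simp: coord_tendsto_def intro: tendsto_diff)

lemma coord_tendsto_mul:
  assumes "coord_tendsto f L F" "coord_tendsto g M F"
  shows "coord_tendsto (\<lambda>t. f t \<odot> g t) (L \<odot> M) F"
  unfolding coord_tendsto_def ga_mul_apply
proof (intro allI tendsto_sum)
  fix A B C
  show "((\<lambda>t. if C = sym_diff A B then f t A * g t B * ga_coef p q r A B else 0) \<longlongrightarrow>
      (if C = sym_diff A B then L A * M B * ga_coef p q r A B else 0)) F"
    using assms by (cases "C = sym_diff A B") (auto simp: coord_tendsto_def intro!: tendsto_intros)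
qed

text \<open>Continuity of inversion at the identity. As there are finitely many coordinates, the
  coordinatewise limit is a limit in \<open>mv_norm\<close>, and
  \<open>mv_norm_inverse_minus_one\<close> squeezes the inverses.\<close>

lemma coord_tendsto_inverse:
  assumes lim: "coord_tendsto f ga_one F" and units: "\<forall>\<^sub>F t in F. f t \<in> units alg"
  shows "coord_tendsto (\<lambda>t. ga_inverse p q r (f t)) ga_one F"
proof -
  have "((\<lambda>t. norm (f t A - ga_one A)) \<longlongrightarrow> 0) F" for A
    using lim by (simp add: coord_tendsto_def tendsto_norm_zero_iff LIM_zero_iff)
  then have "((\<lambda>t. \<Sum>A\<in>Pow idx. norm (f t A - ga_one A)) \<longlongrightarrow> (\<Sum>A\<in>Pow idx. 0)) F"
    by (intro tendsto_sum)
  then have norm0: "((\<lambda>t. mv_norm (f t - ga_one)) \<longlongrightarrow> 0) F"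
    by (simp add: mv_norm_def)
  then have "\<forall>\<^sub>F t in F. mv_norm (f t - ga_one) < 1 / 2"
    by (rule order_tendstoD) simp
  then have ev: "\<forall>\<^sub>F t in F. norm (ga_inverse p q r (f t) A - ga_one A) \<le> 2 * mv_norm (f t - ga_one)" for A
    using units
  proof eventually_elim
    case (elim t)
    have inv: "is_inv (f t) (ga_inverse p q r (f t))" "f t \<in> alg"
      using elim(2) ga_inverse_is_inverse by (auto simp: ga_units_def)
    then have "ga_inverse p q r (f t) - ga_one \<in> alg" by (simp add: ga_is_inverse_def)
    from norm_le_mv_norm[OF this, of A] mv_norm_inverse_minus_one[OF inv(2,1)] elim(1)
    show ?case by simp
  qed
  have "((\<lambda>t. ga_inverse p q r (f t) A - ga_one A) \<longlongrightarrow> 0) F" for A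
    by (rule Lim_null_comparison[OF ev]) (use tendsto_mult_left[OF norm0, of 2] in simp)
  then show ?thesis by (simp add: coord_tendsto_def LIM_zero_iff)
qed

lemma curve_quotient:
  fixes H :: "'f::real_or_complex mv set"
  assumes \<gamma>: "smooth_curve_through_one H \<gamma> X" and H: "H \<subseteq> units alg"
  shows "\<forall>\<^sub>F t in at 0. \<gamma> t \<in> H"
    and "coord_tendsto \<gamma> ga_one (at 0)"
    and "coord_tendsto (\<lambda>t. mv_scale (of_real (1 / t)) (\<gamma> t - ga_one)) X (at 0)"
    and "X \<in> alg"
proof -
  obtain \<epsilon> D where e: "\<epsilon> > 0" "\<And>t. \<bar>t\<bar> < \<epsilon> \<Longrightarrow> \<gamma> t \<in> H" and D: "D 0 = \<gamma>" "D 1 0 = X"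
      "\<And>k t A. \<bar>t\<bar> < \<epsilon> \<Longrightarrow> ((\<lambda>s. D k s A) has_vector_derivative D (Suc k) t A) (at t)"
    and \<gamma>0: "\<gamma> 0 = ga_one"
    using \<gamma> unfolding smooth_curve_through_one_def by blast
  show ev: "\<forall>\<^sub>F t in at 0. \<gamma> t \<in> H"
    unfolding eventually_at using e by (intro exI[of _ \<epsilon>]) (auto simp: dist_real_def)
  have der: "((\<lambda>s. \<gamma> s A) has_vector_derivative X A) (at 0)" for A
    using D(3)[of 0 0 A] e(1) D(1,2) by simp
  have "isCont (\<lambda>s. \<gamma> s A) 0" for A
    using has_vector_derivative_continuous[OF der] by simp
  then show "coord_tendsto \<gamma> ga_one (at 0)"
    using \<gamma>0 by (simp add: coord_tendsto_def isCont_def)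
  show lim: "coord_tendsto (\<lambda>t. mv_scale (of_real (1 / t)) (\<gamma> t - ga_one)) X (at 0)"
    using der unfolding has_vector_derivative_iff_quotient
    by (simp add: coord_tendsto_def mv_scale_def \<gamma>0 scaleR_conv_of_real)
  have "X A = 0" if A: "\<not> A \<subseteq> idx" for A
  proof -
    have "\<forall>\<^sub>F t in at 0. mv_scale (of_real (1 / t)) (\<gamma> t - ga_one) A = 0"
      using ev
    proof eventually_elim
      case (elim t)
      then have "\<gamma> t \<in> alg" using H by (auto simp: ga_units_def)
      then show ?case using A by (auto simp: mv_scale_def ga_def blade_def)
    qed
    then have "((\<lambda>t. mv_scale (of_real (1 / t)) (\<gamma> t - ga_one) A) \<longlongrightarrow> 0) (at 0)"
      by (rule tendsto_eventually)
    then show ?thesis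
      using lim LIM_unique unfolding coord_tendsto_def by blast
  qed
  then show "X \<in> alg" by (simp add: ga_def)
qed

text \<open>For g = \<open>\<gamma> t\<close> with inverse R, the increment is g Y R - Y = (g Y - Y
  g) R, and replacing g by g - 1 leaves the commutator unchanged. So the difference quotient is the
  commutator of the quotient of \<open>\<gamma>\<close> with \<open>Y\<close>, times R, and R tends
  to one.\<close>

lemma is_lie_bracket_commutator:
  assumes H: "H \<subseteq> units alg" and X: "X \<in> lie_algebra H" and Y: "Y \<in> alg"
  shows "is_lie_bracket p q r H X Y (ga_commutator p q r X Y)"
  unfolding is_lie_bracket_def
proof (intro allI impI)
  fix \<gamma> A
  assume \<gamma>: "smooth_curve_through_one H \<gamma> X"
  note c = curve_quotient[OF \<gamma> H]
  let ?R = "\<lambda>t. ga_inverse p q r (\<gamma> t)"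
  let ?dq = "\<lambda>t. mv_scale (of_real (1 / t)) (\<gamma> t - ga_one)"
  have \<gamma>0: "\<gamma> 0 = ga_one" using \<gamma> by (simp add: smooth_curve_through_one_def)
  have one: "is_inv ga_one ga_one" by (simp add: ga_is_inverse_def)
  then have "ga_one \<in> units alg" by (auto simp: ga_units_def)
  then have "is_inv ga_one (?R 0)" using ga_inverse_is_inverse[of ga_one alg] \<gamma>0 by simp
  then have R0: "?R 0 = ga_one" by (rule inverse_unique[OF one_in_alg _ one])
  have un: "\<forall>\<^sub>F t in at 0. \<gamma> t \<in> units alg"
    using c(1) by eventually_elim (use H in auto)
  have "coord_tendsto (\<lambda>t. (?dq t \<odot> Y - Y \<odot> ?dq t) \<odot> ?R t) ((X \<odot> Y - Y \<odot> X) \<odot> ga_one) (at 0)"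
    by (intro coord_tendsto_mul coord_tendsto_diff coord_tendsto_const coord_tendsto_inverse c un)
  then have lim: "((\<lambda>t. ((?dq t \<odot> Y - Y \<odot> ?dq t) \<odot> ?R t) A) \<longlongrightarrow> ga_commutator p q r X Y A) (at 0)"
    by (simp add: coord_tendsto_def ga_commutator_def)
  have "\<forall>\<^sub>F t in at 0. ((?dq t \<odot> Y - Y \<odot> ?dq t) \<odot> ?R t) A =
      (1 / t) *\<^sub>R ((\<gamma> t \<odot> Y \<odot> ?R t) A - (\<gamma> 0 \<odot> Y \<odot> ?R 0) A)"
    using un
  proof eventually_elim
    case (elim t)
    then have g: "\<gamma> t \<in> alg" and "is_inv (\<gamma> t) (?R t)"
      using ga_inverse_is_inverse by (auto simp: ga_units_def)
    then have R: "?R t \<in> alg" "\<gamma> t \<odot> ?R t = ga_one" by (auto simp: ga_is_inverse_def)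
    have "(?dq t \<odot> Y - Y \<odot> ?dq t) \<odot> ?R t = mv_scale (of_real (1 / t)) ((\<gamma> t \<odot> Y - Y \<odot> \<gamma> t) \<odot> ?R t)"
      using Y by (simp add: ga_mul_scale_left ga_mul_scale_right ga_mul_diff_left ga_mul_diff_right
        mv.scale_right_diff_distrib)
    also have "(\<gamma> t \<odot> Y - Y \<odot> \<gamma> t) \<odot> ?R t = \<gamma> t \<odot> Y \<odot> ?R t - Y"
      using Y g R by (simp add: ga_mul_diff_left mul_assoc)
    finally show ?case
      by (simp only: \<gamma>0 R0[unfolded \<gamma>0]) (use Y in \<open>simp add: mv_scale_def scaleR_conv_of_real\<close>)
  qed
  then show "((\<lambda>t. (\<gamma> t \<odot> Y \<odot> ?R t) A) has_vector_derivative ga_commutator p q r X Y A) (at 0)"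
    unfolding has_vector_derivative_iff_quotient
    using lim by (subst filterlim_cong[OF refl refl, symmetric]) auto
qed

text \<open>
  The relation \<open>grade_inv T = T \<odot> W\<close> with \<open>W\<close> in a coordinate subspace survives differentiation at
  the identity, where it says that \<open>grade_inv X - X\<close>, that is, the odd part of \<open>X\<close>, lies in that
  subspace.
\<close>

lemma lie_algebra_subset_supported_on:
  fixes H :: "'f::real_or_complex mv set"
  assumes H: "H \<subseteq> units alg" and F: "{} \<in> F"
    and W: "\<And>T. T \<in> H \<Longrightarrow> \<exists>W\<in>supported_on F. W \<in> alg \<and> grade_inv T = T \<odot> W"
  shows "lie_algebra H \<subseteq> supported_on {A. A \<subseteq> idx \<and> (even (card A) \<or> A \<in> F)}"
proof
  fix X assume "X \<in> lie_algebra H"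
  then obtain \<gamma> where \<gamma>: "smooth_curve_through_one H \<gamma> X" by (auto simp: lie_algebra_def)
  note c = curve_quotient[OF \<gamma> H]
  let ?R = "\<lambda>t. ga_inverse p q r (\<gamma> t)"
  let ?dq = "\<lambda>t. mv_scale (of_real (1 / t)) (\<gamma> t - ga_one)"
  have un: "\<forall>\<^sub>F t in at 0. \<gamma> t \<in> units alg"
    using c(1) by eventually_elim (use H in auto)
  have "coord_tendsto (\<lambda>t. grade_inv (?dq t)) (grade_inv X) (at 0)"
    using c(3) by (auto simp: coord_tendsto_def grade_inv_def intro: tendsto_mult_left)
  \<comment> \<open>Multiplying by the inverse of \<open>\<gamma> t\<close> isolates a multiple of
    \<open>W - ga_one\<close>. The element \<open>W\<close> is chosen for each \<open>t\<close>
    without any continuity; its coordinates outside \<open>F\<close> vanish every time, hence also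
    in the limit.\<close>
  then have lim: "coord_tendsto (\<lambda>t. ?R t \<odot> (grade_inv (?dq t) - ?dq t)) (ga_one \<odot> (grade_inv X - X)) (at 0)"
    by (intro coord_tendsto_mul coord_tendsto_diff coord_tendsto_inverse c un)
  have gX: "grade_inv X - X \<in> alg" using c(4) by (auto simp: ga_def grade_inv_def)
  have "X A = 0" if A: "odd (card A)" "A \<notin> F" for A
  proof -
    have "\<forall>\<^sub>F t in at 0. (?R t \<odot> (grade_inv (?dq t) - ?dq t)) A = 0"
      using c(1)
    proof eventually_elim
      case (elim t)
      then have g: "\<gamma> t \<in> alg" and "is_inv (\<gamma> t) (?R t)"
        using H ga_inverse_is_inverse by (auto simp: ga_units_def)
      then have R: "?R t \<in> alg" "?R t \<odot> \<gamma> t = ga_one" by (auto simp: ga_is_inverse_def)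
      obtain W where W: "W \<in> supported_on F" "W \<in> alg" "grade_inv (\<gamma> t) = \<gamma> t \<odot> W"
        using W[OF elim] by blast
      have "grade_inv (?dq t) - ?dq t = mv_scale (of_real (1 / t)) (grade_inv (\<gamma> t) - \<gamma> t)"
        by (rule ext) (auto simp: grade_inv_def mv_scale_def blade_def algebra_simps)
      also have "\<dots> = mv_scale (of_real (1 / t)) (\<gamma> t \<odot> (W - ga_one))"
        using g W by (simp add: ga_mul_diff_right)
      finally have "?R t \<odot> (grade_inv (?dq t) - ?dq t) = mv_scale (of_real (1 / t)) (?R t \<odot> (\<gamma> t \<odot> (W - ga_one)))"
        by (simp add: ga_mul_scale_right)
      also have "?R t \<odot> (\<gamma> t \<odot> (W - ga_one)) = W - ga_one"
        using g R W by (simp flip: mul_assoc)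
      finally have eq: "?R t \<odot> (grade_inv (?dq t) - ?dq t) = mv_scale (of_real (1 / t)) (W - ga_one)" .
      have "A \<noteq> {}" using A(1) by auto
      then have "mv_scale (of_real (1 / t)) (W - ga_one) A = 0"
        using W(1) A(2) by (auto simp: mv_scale_def supported_on_def blade_def)
      then show ?case by (simp only: eq)
    qed
    then have "((\<lambda>t. (?R t \<odot> (grade_inv (?dq t) - ?dq t)) A) \<longlongrightarrow> 0) (at 0)"
      by (rule tendsto_eventually)
    moreover have "((\<lambda>t. (?R t \<odot> (grade_inv (?dq t) - ?dq t)) A) \<longlongrightarrow> (grade_inv X - X) A) (at 0)"
      using lim gX by (simp add: coord_tendsto_def)
    ultimately have "(grade_inv X - X) A = 0" using LIM_unique by blast
    then have "2 * X A = 0" using A(1) by (simp add: grade_inv_def)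
    then show ?thesis by simp
  qed
  then show "X \<in> supported_on {A. A \<subseteq> idx \<and> (even (card A) \<or> A \<in> F)}"
    using c(4) by (auto simp: supported_on_def ga_def)
qed

text \<open>The product is a cubic polynomial in \<open>t\<close> with linear coefficient
  \<open>X + Y + Z\<close>. Its derivatives are explicit and vanish from order four on, so the
  witness \<open>D\<close> for smoothness can be written down.\<close>

lemma product_curve_in_lie_algebra:
  fixes X Y Z :: "'f::real_or_complex mv"
  assumes XYZ: "X \<in> alg" "Y \<in> alg" "Z \<in> alg" and e: "\<epsilon> > 0"
    and H: "\<And>t. \<bar>t\<bar> < \<epsilon> \<Longrightarrow>
      (ga_one + mv_scale (of_real t) X) \<odot> (ga_one + mv_scale (of_real t) Y) \<odot>
        (ga_one + mv_scale (of_real t) Z) \<in> H"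
  shows "X + Y + Z \<in> lie_algebra H"
proof -
  define P where "P = X + Y + Z"
  define Q where "Q = X \<odot> Y + X \<odot> Z + Y \<odot> Z"
  define R where "R = X \<odot> Y \<odot> Z"
  define D :: "nat \<Rightarrow> real \<Rightarrow> 'f mv" where "D = (\<lambda>k t.
    if k = 0 then ga_one + mv_scale (of_real t) P + mv_scale (of_real (t^2)) Q + mv_scale (of_real (t^3)) R
    else if k = 1 then P + mv_scale (of_real (2 * t)) Q + mv_scale (of_real (3 * t^2)) R
    else if k = 2 then mv_scale 2 Q + mv_scale (of_real (6 * t)) R
    else if k = 3 then mv_scale 6 R else 0)"
  have prod: "(ga_one + mv_scale (of_real t) X) \<odot> (ga_one + mv_scale (of_real t) Y) \<odot>
        (ga_one + mv_scale (of_real t) Z) = D 0 t" for t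
    using XYZ unfolding D_def P_def Q_def R_def
    by (simp add: ga_mul_add_left ga_mul_add_right ga_mul_scale_left ga_mul_scale_right
        mv.scale_right_distrib power2_eq_square power3_eq_cube mult.assoc algebra_simps)
  have pow: "((\<lambda>s. of_real (a * s ^ n) * c) has_vector_derivative of_real (a * (real n * t ^ (n - 1))) * c) (at t)"
    for a n t and c :: 'f
    by (intro has_vector_derivative_mult_left has_vector_derivative_of_real DERIV_cmult)
      (use DERIV_pow[of n t] in simp)
  have der: "((\<lambda>s. D k s A) has_vector_derivative D (Suc k) t A) (at t)" for k t A
  proof -
    consider "k = 0" | "k = 1" | "k = 2" | "k = 3" | "k > 3" by linarith
    then show ?thesis
    proof cases
      case 1
      have "((\<lambda>s. ga_one A + of_real (1 * s ^ 1) * P A + of_real (1 * s ^ 2) * Q A + of_real (1 * s ^ 3) * R A)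
          has_vector_derivative 0 + of_real (1 * (real 1 * t ^ (1 - 1))) * P A +
            of_real (1 * (real 2 * t ^ (2 - 1))) * Q A + of_real (1 * (real 3 * t ^ (3 - 1))) * R A) (at t)"
        by (intro has_vector_derivative_add has_vector_derivative_const pow)
      then show ?thesis by (simp add: 1 D_def mv_scale_def)
    next
      case 2
      have "((\<lambda>s. P A + of_real (2 * s ^ 1) * Q A + of_real (3 * s ^ 2) * R A)
          has_vector_derivative 0 + of_real (2 * (real 1 * t ^ (1 - 1))) * Q A +
            of_real (3 * (real 2 * t ^ (2 - 1))) * R A) (at t)"
        by (intro has_vector_derivative_add has_vector_derivative_const pow)
      then show ?thesis by (simp add: 2 D_def mv_scale_def)
    next
      case 3
      have "((\<lambda>s. 2 * Q A + of_real (6 * s ^ 1) * R A)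
          has_vector_derivative 0 + of_real (6 * (real 1 * t ^ (1 - 1))) * R A) (at t)"
        by (intro has_vector_derivative_add has_vector_derivative_const pow)
      then show ?thesis by (simp add: 3 D_def mv_scale_def)
    qed (auto simp: D_def)
  qed
  have "smooth_curve_through_one H (D 0) P"
    unfolding smooth_curve_through_one_def
  proof (intro conjI exI[of _ \<epsilon>] exI[of _ D] allI impI)
    show "D 0 0 = ga_one" "D 1 0 = P" by (auto simp: D_def)
  qed (use e H der prod in auto)
  then show ?thesis by (auto simp: lie_algebra_def P_def)
qed

end

section \<open>Grassmann subalgebra, center and radical\<close>

text \<open>The two families may overlap; the common coordinates all go to \<open>X\<close>.\<close>

lemma supported_on_decomp:
  assumes "U \<in> supported_on (G \<union> H)"
  obtains X Y where "X \<in> supported_on G" "Y \<in> supported_on H" "U = X + (Y :: 'f::real_or_complex mv)"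
proof
  show "(\<lambda>A. if A \<in> G then U A else 0) \<in> supported_on G" by (simp add: supported_on_def)
  show "(\<lambda>A. if A \<in> G then 0 else U A) \<in> supported_on H" using assms by (auto simp: supported_on_def)
  show "U = (\<lambda>A. if A \<in> G then U A else 0) + (\<lambda>A. if A \<in> G then 0 else U A)" by auto
qed

lemma mv_set_add_supported_on:
  "mv_set_add (supported_on G) (supported_on H) = (supported_on (G \<union> H) :: 'f::real_or_complex mv set)"
proof (intro equalityI subsetI)
  fix U :: "'f mv" assume "U \<in> supported_on (G \<union> H)"
  then show "U \<in> mv_set_add (supported_on G) (supported_on H)"
    by (rule supported_on_decomp) (auto simp: mv_set_add_def)
qed (auto simp: mv_set_add_def supported_on_def)

lemma ga_par_eq_supported_on:
  "ga_par p q r k = (supported_on {A. A \<subseteq> {1..p+q+r} \<and> (even (card A) \<longleftrightarrow> even k)} :: 'f::real_or_complex mv set)"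
proof (intro equalityI subsetI)
  fix U :: "'f mv" assume U: "U \<in> ga_par p q r k"
  have "U A = 0" if "\<not> (A \<subseteq> {1..p+q+r} \<and> (even (card A) \<longleftrightarrow> even k))" for A
  proof (cases "A \<subseteq> {1..p+q+r}")
    case True
    have "(-1) ^ card A * U A = (-1) ^ k * U A"
      using U by (auto simp: ga_par_def grade_inv_def mv_scale_def fun_eq_iff)
    then have "2 * U A = 0" using True that by (cases "even k") (auto simp: neg_eq_iff_add_eq_0 minus_equation_iff)
    then show ?thesis by simp
  qed (use U in \<open>auto simp: ga_par_def ga_def\<close>)
  then show "U \<in> supported_on {A. A \<subseteq> {1..p+q+r} \<and> (even (card A) \<longleftrightarrow> even k)}"
    by (auto simp: supported_on_def)
next
  fix U :: "'f mv" assume U: "U \<in> supported_on {A. A \<subseteq> {1..p+q+r} \<and> (even (card A) \<longleftrightarrow> even k)}"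
  have "(-1) ^ card A * U A = (-1) ^ k * U A" for A
  proof (cases "U A = 0")
    case False
    then have "even (card A) \<longleftrightarrow> even k" using U unfolding supported_on_def by blast
    then show ?thesis by (simp add: uminus_power_if)
  qed simp
  then show "U \<in> ga_par p q r k"
    using U by (auto simp: ga_par_def ga_def grade_inv_def mv_scale_def supported_on_def)
qed

lemma grade_eq_supported_on:
  "grade p q r k = (supported_on {A. A \<subseteq> {1..p+q+r} \<and> card A = k} :: 'f::real_or_complex mv set)"
  unfolding grade_def by (rule span_blade_image) simp

context geometric_algebra
begin

abbreviation null :: "nat set" where "null \<equiv> {p+q+1..p+q+r}"

lemma subalgebra_supported_on:
  assumes "F \<subseteq> Pow idx" "{} \<in> F"
    and "\<And>A B. A \<in> F \<Longrightarrow> B \<in> F \<Longrightarrow> A \<inter> B \<subseteq> {..p+q} \<Longrightarrow> sym_diff A B \<in> F"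
  shows "subalgebra (supported_on F)"
  unfolding ga_subalgebra_def ga_eq_supported_on
  using assms by (auto intro: supported_on_mono[THEN subsetD] subspace_supported_on blade_in_supported_on
    ga_mul_in_supported_on)

section \<open>The Grassmann subalgebra and the center\<close>

lemma grassmann_eq_supported_on:
  "grassmann p q r = (supported_on (Pow null) :: 'f::real_or_complex mv set)"
proof (intro equalityI)
  have "subalgebra (supported_on (Pow null) :: 'f mv set)"
    by (rule subalgebra_supported_on) auto
  moreover have "ga_gen ` null \<subseteq> (supported_on (Pow null) :: 'f mv set)"
    by (auto intro!: blade_in_supported_on)
  ultimately show "grassmann p q r \<subseteq> (supported_on (Pow null) :: 'f mv set)"
    unfolding grassmann_def by (intro Inter_lower) simp
next
  have "supported_on (Pow null) \<subseteq> S" if S: "subalgebra S" "ga_gen ` null \<subseteq> S" for S :: "'f mv set"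
  proof -
    have "blade A \<in> S" if "A \<subseteq> null" for A
      using finite_subset[OF that finite_atLeastAtMost] that
    proof (induction A rule: finite_linorder_min_induct)
      case empty
      then show ?case using S by (simp add: ga_subalgebra_def)
    next
      case (insert b A)
      have A: "{b} \<subseteq> idx" "A \<subseteq> idx" "b \<notin> A" using insert by auto
      \<comment> \<open>Since \<open>b\<close> is smaller than all elements of \<open>A\<close>, no
        pair is out of order and the product of the two blades carries no sign.\<close>
      have *: "{(x, y). x = b \<and> y \<in> A \<and> y < x} = {}" using insert by auto
      have "(ga_gen b :: 'f mv) \<odot> blade A = blade (insert b A)"
        using A by (subst blade_mul) (auto simp: ga_coef_def * intro!: arg_cong[of _ _ blade])
      moreover have "(ga_gen b :: 'f mv) \<odot> blade A \<in> S"
        using S insert unfolding ga_subalgebra_def by blast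
      ultimately show ?case by metis
    qed
    then have "mv.span (blade ` Pow null) \<subseteq> S"
      using S by (intro mv.span_minimal) (auto simp: ga_subalgebra_def)
    then show ?thesis by (simp add: span_blade_image)
  qed
  then show "(supported_on (Pow null) :: 'f mv set) \<subseteq> grassmann p q r"
    unfolding grassmann_def by blast
qed

text \<open>Commuting with a generator can be tested one coordinate at a time. The products of
  \<open>ga_gen a\<close> and \<open>blade A\<close> in the two orders differ by a sign with
  exponent \<open>card A + card ({a} \<inter> A)\<close>; if it is odd and the product is nonzero,
  \<open>X A\<close> must vanish. For even \<open>card A\<close> this rules out non-null
  \<open>a\<close> in \<open>A\<close>, for odd \<open>card A\<close> any \<open>a\<close> outside
  \<open>A\<close>.\<close>

lemma center_subset_supported_on:
  "ga_center p q r \<subseteq> (supported_on ({A. A \<subseteq> null \<and> even (card A)} \<union> {A. A = idx \<and> odd (card A)}) :: 'f::real_or_complex mv set)"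
proof
  fix X :: "'f mv" assume "X \<in> ga_center p q r"
  then have X: "X \<in> alg" "\<And>V. V \<in> alg \<Longrightarrow> X \<odot> V = V \<odot> X" by (auto simp: ga_center_def)
  have "A \<in> {A. A \<subseteq> null \<and> even (card A)} \<union> {A. A = idx \<and> odd (card A)}" if XA: "X A \<noteq> 0" for A
  proof -
    have A: "A \<subseteq> idx" using XA X by (auto simp: ga_def)
    have sign: "\<not> (odd (card A + card ({a} \<inter> A)) \<and> {a} \<inter> A \<subseteq> {..p+q})" if a: "a \<in> idx" for a
    proof
      assume *: "odd (card A + card ({a} \<inter> A)) \<and> {a} \<inter> A \<subseteq> {..p+q}"
      let ?C = "sym_diff {a} A"
      have C: "?C \<subseteq> idx" using a A by auto
      have "(ga_gen a \<odot> X) ?C = (\<Sum>A'\<in>Pow idx. if A' = {a} then X A * ga_coef p q r {a} A else 0)"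
        unfolding ga_mul_nth[OF C]
      proof (intro sum.cong refl)
        have "sym_diff {a} ?C = A" by auto
        then show "ga_gen a A' * X (sym_diff A' ?C) * ga_coef p q r A' (sym_diff A' ?C) =
            (if A' = {a} then X A * ga_coef p q r {a} A else 0)" for A'
          by (simp add: blade_def[of "{a}"])
      qed
      moreover have "(X \<odot> ga_gen a) ?C = (\<Sum>A'\<in>Pow idx. if A' = A then X A * ga_coef p q r A {a} else 0)"
        unfolding ga_mul_nth[OF C]
      proof (intro sum.cong refl)
        fix A'
        have "sym_diff A ?C = {a}" "sym_diff A' ?C = {a} \<longleftrightarrow> A' = A" by auto
        then show "X A' * ga_gen a (sym_diff A' ?C) * ga_coef p q r A' (sym_diff A' ?C) =
            (if A' = A then X A * ga_coef p q r A {a} else 0)"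
          by (auto simp: blade_def[of "{a}"])
      qed
      ultimately have "X A * ga_coef p q r {a} A = X A * ga_coef p q r A {a}"
        using X(2)[OF blade_in_ga, of "{a}"] a A by simp
      then have "ga_coef p q r A {a} = (ga_coef p q r {a} A :: 'f)" using XA by simp
      moreover have "ga_coef p q r {a} A = (-1) ^ (card A + card ({a} \<inter> A)) * (ga_coef p q r A {a} :: 'f)"
        using ga_coef_swap[of "{a}" A] finite_idx_subset[OF A] by simp
      ultimately have "2 * (ga_coef p q r {a} A :: 'f) = 0" using * by (simp add: eq_neg_iff_add_eq_0 minus_equation_iff)
      then show False using * ga_coef_eq_0_iff[of "{a}" p q r A, where 'f='f] by simp
    qed
    show ?thesis
    proof (cases "even (card A)")
      case True
      have "a \<in> null" if "a \<in> A" for a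
        using sign[of a] that A True by auto
      then show ?thesis using True by auto
    next
      case False
      have "a \<in> A" if "a \<in> idx" for a
        using sign[of a] that False by (cases "a \<in> A") auto
      then have "A = idx" using A by auto
      then show ?thesis using False by auto
    qed
  qed
  then show "X \<in> supported_on ({A. A \<subseteq> null \<and> even (card A)} \<union> {A. A = idx \<and> odd (card A)})"
    unfolding supported_on_def by blast
qed

lemma subspace_center: "mv.subspace (ga_center p q r)"
  by (auto simp: mv.subspace_def ga_center_def ga_mul_add_left ga_mul_add_right ga_mul_scale_left
    ga_mul_scale_right ga_mul_zero_left ga_mul_zero_right)

lemma one_in_center: "ga_one \<in> ga_center p q r"
  by (auto simp: ga_center_def)

text \<open>By \<open>ga_coef_swap\<close> the sign between \<open>blade idx\<close> and
  \<open>blade A\<close> has exponent n \<open>card A\<close> + \<open>card A\<close>, which is even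
  for odd n.\<close>

lemma supported_on_idx_subset_center:
  assumes "odd (p + q + r)"
  shows "(supported_on {idx} :: 'f::real_or_complex mv set) \<subseteq> ga_center p q r"
proof -
  have "blade idx \<odot> V = V \<odot> blade idx" if "V \<in> alg" for V :: "'f mv"
    using that
  proof (induction rule: ga_induct)
    case (blade A)
    have "ga_coef p q r idx A = (ga_coef p q r A idx :: 'f)"
      using ga_coef_swap[of idx A] finite_idx_subset[OF blade] blade assms by (simp add: Int_absorb1)
    then show ?case using blade by (simp add: blade_mul Un_commute)
  qed (simp_all only: ga_mul_add_left ga_mul_add_right ga_mul_scale_left ga_mul_scale_right)
  then have "blade idx \<in> (ga_center p q r :: 'f mv set)"
    by (simp add: ga_center_def blade_in_ga)
  then have "mv.span (blade ` {idx}) \<subseteq> (ga_center p q r :: 'f mv set)"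
    by (intro mv.span_minimal subspace_center) simp
  then show ?thesis by (simp only: span_blade_image finite.intros)
qed

section \<open>Left ideals and the Jacobson radical\<close>

lemma left_ideal_scale:
  assumes "ga_left_ideal p q r I" "V \<in> I"
  shows "mv_scale c V \<in> I"
proof -
  have "V \<in> alg" using assms by (auto simp: ga_left_ideal_def)
  then have "mv_scale c V = mv_scale c ga_one \<odot> V" by (simp add: ga_mul_scale_left)
  moreover have "mv_scale c ga_one \<odot> V \<in> I" using assms by (simp add: ga_left_ideal_def)
  ultimately show ?thesis by simp
qed

lemma left_ideal_subspace: "ga_left_ideal p q r I \<Longrightarrow> mv.subspace I"
  using left_ideal_scale by (auto simp: mv.subspace_def ga_left_ideal_def)

lemma left_ideal_eq_alg:
  fixes I :: "'f::real_or_complex mv set"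
  assumes "ga_left_ideal p q r I" "ga_one \<in> I"
  shows "I = alg"
proof
  show "alg \<subseteq> I"
  proof
    fix U :: "'f mv" assume U: "U \<in> alg"
    then have "U \<odot> ga_one \<in> I" using assms unfolding ga_left_ideal_def by blast
    then show "U \<in> I" using U by simp
  qed
qed (use assms in \<open>simp add: ga_left_ideal_def\<close>)

text \<open>Zorn's lemma, with properness expressed as not containing \<open>ga_one\<close>: in this
  form it passes to unions of chains, and \<open>left_ideal_eq_alg\<close> translates it
  back.\<close>

lemma maximal_left_ideal_exists:
  assumes Q: "ga_left_ideal p q r Q" "ga_one \<notin> Q"
  obtains M where "ga_maximal_left_ideal p q r M" "Q \<subseteq> M"
proof -
  let ?P = "{I. ga_left_ideal p q r I \<and> Q \<subseteq> I \<and> ga_one \<notin> I}"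
  have "\<exists>M\<in>?P. \<forall>X\<in>?P. M \<subseteq> X \<longrightarrow> X = M"
  proof (rule subset_Zorn_nonempty)
    fix C assume C: "C \<noteq> {}" "subset.chain ?P C"
    have ideal: "ga_left_ideal p q r I" if "I \<in> C" for I
      using that C by (auto simp: subset.chain_def)
    have "U + V \<in> \<Union>C" if UV: "U \<in> \<Union>C" "V \<in> \<Union>C" for U V
    proof -
      obtain I J where "I \<in> C" "J \<in> C" "U \<in> I" "V \<in> J" using UV by auto
      moreover from this have "I \<subseteq> J \<or> J \<subseteq> I" using C by (auto simp: subset.chain_def)
      ultimately show ?thesis using ideal unfolding ga_left_ideal_def by blast
    qed
    then have "ga_left_ideal p q r (\<Union>C)"
      using ideal C(1) unfolding ga_left_ideal_def by blast
    then show "\<Union>C \<in> ?P" using C by (auto simp: subset.chain_def)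
  qed (use Q in auto)
  then obtain M where M: "M \<in> ?P" and max: "\<forall>X\<in>?P. M \<subseteq> X \<longrightarrow> X = M" by (rule bexE)
  have "I = M \<or> I = alg" if "ga_left_ideal p q r I" "M \<subseteq> I" for I
  proof (cases "ga_one \<in> I")
    case False
    then have "I \<in> ?P" using that M by auto
    then show ?thesis using max that(2) by simp
  qed (simp add: left_ideal_eq_alg that(1))
  then have "ga_maximal_left_ideal p q r M"
    using M one_in_alg unfolding ga_maximal_left_ideal_def by blast
  then show thesis using M that by auto
qed

lemma left_ideal_rad: "ga_left_ideal p q r (ga_rad p q r)"
  by (auto simp: ga_left_ideal_def ga_rad_def ga_maximal_left_ideal_def)

abbreviation null_ideal :: "'f::real_or_complex mv set" where
  "null_ideal \<equiv> supported_on {A. A \<subseteq> idx \<and> A \<inter> null \<noteq> {}}"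

text \<open>A null index cancels only if it is shared. So the numbers of null indices add in every
  nonzero product of blades, which is the source of nilpotency.\<close>

lemma sym_diff_Int_null:
  assumes "A \<subseteq> idx" "A \<inter> B \<subseteq> {..p+q}"
  shows "sym_diff A B \<inter> null = (A \<inter> null) \<union> (B \<inter> null)" "(A \<inter> null) \<inter> (B \<inter> null) = {}"
  using assms by (fastforce, fastforce)

text \<open>Here \<open>y \<odot> v = v\<close>, and each multiplication by \<open>y\<close> raises
  the number of null indices in the support by at least one. By iteration every index set in the
  support of \<open>v\<close> would contain more than \<open>card null\<close> null indices.\<close>

lemma one_minus_null_ideal_injective:
  assumes y: "y \<in> null_ideal" and v: "v \<in> alg" "(ga_one - y) \<odot> v = 0"
  shows "v = (0 :: 'f::real_or_complex mv)"
proof -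
  have eq: "y \<odot> v = v" using v by (simp add: ga_mul_diff_left)
  have "v \<in> supported_on {A. A \<subseteq> idx \<and> k \<le> card (A \<inter> null)}" for k
  proof (induction k)
    case 0
    then show ?case using v by (auto simp: ga_def supported_on_def)
  next
    case (Suc k)
    have "y \<odot> v \<in> supported_on {A. A \<subseteq> idx \<and> Suc k \<le> card (A \<inter> null)}"
    proof (rule ga_mul_in_supported_on[OF y Suc], intro CollectI conjI)
      fix A B
      assume A: "A \<in> {A. A \<subseteq> idx \<and> A \<inter> null \<noteq> {}}" and B: "B \<in> {A. A \<subseteq> idx \<and> k \<le> card (A \<inter> null)}"
        and "A \<inter> B \<subseteq> {..p+q}"
      note s = sym_diff_Int_null[OF _ \<open>A \<inter> B \<subseteq> {..p+q}\<close>]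
      have "card (sym_diff A B \<inter> null) = card (A \<inter> null) + card (B \<inter> null)"
        using A s by (simp add: card_Un_disjoint)
      moreover have "card (A \<inter> null) > 0" using A by (simp add: card_gt_0_iff)
      ultimately show "Suc k \<le> card (sym_diff A B \<inter> null)" using B by simp
    qed auto
    then show ?case by (simp add: eq)
  qed
  from this[of "Suc (card null)"] have "v A = 0" for A
    using card_mono[of null "A \<inter> null"] by (auto simp: supported_on_def)
  then show ?thesis by auto
qed

text \<open>If \<open>x\<close> were outside a maximal left ideal \<open>M\<close>, then
  \<open>M\<close> and \<open>null_ideal\<close> together would span everything, so
  \<open>ga_one = m + y\<close> with \<open>m\<close> in \<open>M\<close> and \<open>y\<close> in
  \<open>null_ideal\<close>. But \<open>m = ga_one - y\<close> is invertible, which makes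
  \<open>M\<close> improper.\<close>

lemma null_ideal_subset_rad: "null_ideal \<subseteq> (ga_rad p q r :: 'f::real_or_complex mv set)"
proof
  fix x :: "'f mv" assume x: "x \<in> null_ideal"
  have alg: "null_ideal \<subseteq> (alg :: 'f mv set)"
    unfolding ga_eq_supported_on by (rule supported_on_mono) auto
  have "x \<in> M" if M: "ga_maximal_left_ideal p q r M" for M
  proof (rule ccontr)
    assume "x \<notin> M"
    have M': "ga_left_ideal p q r M" "M \<noteq> alg" "\<And>I. ga_left_ideal p q r I \<Longrightarrow> M \<subseteq> I \<Longrightarrow> I = M \<or> I = alg"
      using M by (auto simp: ga_maximal_left_ideal_def)
    have sub: "mv.subspace M" "mv.subspace (null_ideal :: 'f mv set)" "M \<subseteq> alg"
      using M'(1) by (auto simp: left_ideal_subspace subspace_supported_on ga_left_ideal_def)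
    let ?J = "mv_set_add M null_ideal"
    have MJ: "M \<subseteq> ?J" and NJ: "null_ideal \<subseteq> ?J"
      using mv.subspace_0[OF sub(1)] mv.subspace_0[OF sub(2)] unfolding mv_set_add_def
      by (blast intro: add_0_right[symmetric], blast intro: add_0_left[symmetric])
    have "U \<odot> V \<in> null_ideal" if "U \<in> alg" "V \<in> null_ideal" for U V :: "'f mv"
      using that(1) unfolding ga_eq_supported_on
    proof (rule ga_mul_in_supported_on[OF _ that(2)], intro CollectI conjI)
      fix A B assume "A \<subseteq> idx" "B \<in> {A. A \<subseteq> idx \<and> A \<inter> null \<noteq> {}}" "A \<inter> B \<subseteq> {..p+q}"
      then show "sym_diff A B \<inter> null \<noteq> {}" using sym_diff_Int_null[of A B] by auto
    qed auto
    then have mul: "U \<odot> V \<in> ?J" if "U \<in> alg" "V \<in> ?J" for U V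
      using that M'(1) unfolding mv_set_add_def ga_left_ideal_def
      by (clarsimp simp: ga_mul_add_right) blast
    have "ga_left_ideal p q r ?J"
      unfolding ga_left_ideal_def
    proof (intro conjI ballI mul)
      show "?J \<subseteq> alg"
        unfolding mv_set_add_def using sub(3) alg by (blast intro: add_in_alg)
      show "0 \<in> ?J" using MJ mv.subspace_0[OF sub(1)] by auto
      fix U V assume "U \<in> ?J" "V \<in> ?J"
      then obtain u u' v v' where "U = u + u'" "V = v + v'" "u \<in> M" "v \<in> M" "u' \<in> null_ideal" "v' \<in> null_ideal"
        by (auto simp: mv_set_add_def)
      moreover from this have "U + V = (u + v) + (u' + v')" by simp
      ultimately show "U + V \<in> ?J"
        using mv.subspace_add[OF sub(1)] mv.subspace_add[OF sub(2)] unfolding mv_set_add_def by blast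
    qed
    then have "?J = alg" using M'(3)[OF _ MJ] x NJ \<open>x \<notin> M\<close> by blast
    then have "ga_one \<in> ?J" by simp
    then obtain m y where my: "m \<in> M" "y \<in> null_ideal" "ga_one = m + y"
      unfolding mv_set_add_def by blast
    then have m: "m = ga_one - y" by simp
    have "\<exists>V\<in>alg. is_inv m V"
      unfolding m
    proof (rule injective_imp_inverse[OF subalgebra_alg])
      show "ga_one - y \<in> alg" using my(2) alg by (intro diff_in_alg) auto
    qed (rule one_minus_null_ideal_injective[OF my(2)])
    then obtain V where "V \<in> alg" "V \<odot> m = ga_one" by (auto simp: ga_is_inverse_def)
    then have "ga_one \<in> M" using M'(1) my(1) unfolding ga_left_ideal_def by metis
    then show False using left_ideal_eq_alg[OF M'(1)] M'(2) by simp
  qed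
  then show "x \<in> ga_rad p q r" using x alg by (auto simp: ga_rad_def)
qed

text \<open>
  Maschke's argument: averaging a linear projection onto \<open>J\<close> over the blades, which form a finite
  group up to scalars, turns it into right multiplication by an element \<open>e\<close> of \<open>J\<close>.
\<close>

lemma right_unit_of_nondegenerate_left_ideal:
  fixes J :: "'f::real_or_complex mv set"
  assumes J: "mv.subspace J" "J \<subseteq> supported_on (Pow {1..p+q})"
    and mul: "\<And>A U. A \<subseteq> {1..p+q} \<Longrightarrow> U \<in> J \<Longrightarrow> blade A \<odot> U \<in> J"
  obtains e where "e \<in> J" "\<And>v. v \<in> J \<Longrightarrow> v \<odot> e = v"
proof -
  let ?P = "Pow {1..p+q}"
  obtain \<pi> where \<pi>: "range \<pi> \<subseteq> J" "Vector_Spaces.linear mv_scale mv_scale \<pi>" "\<And>v. v \<in> J \<Longrightarrow> \<pi> v = v"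
    using mv_pair.linear_exists_left_inverse_on[OF mv.linear_id J(1)] by auto
  interpret \<pi>: Vector_Spaces.linear mv_scale mv_scale \<pi> by fact
  define c where "c A = (ga_coef p q r A A :: 'f)" for A
  have sub: "A \<subseteq> idx" if "A \<in> ?P" for A using that by auto
  have Jalg: "J \<subseteq> alg"
    using J(2) supported_on_mono[of ?P "Pow idx"] unfolding ga_eq_supported_on by fastforce
  have c: "c A \<noteq> 0" if "A \<in> ?P" for A
    using that ga_coef_eq_0_iff[OF finite_idx_subset[OF sub[OF that]], of p q r A, where 'f='f]
    by (auto simp: c_def)
  \<comment> \<open>The square of \<open>blade A\<close> is the scalar \<open>c A\<close>, nonzero
    in the absence of null indices. So \<open>blade A\<close> divided by \<open>c A\<close> is the
    inverse of \<open>blade A\<close>, and this is the mean of the conjugates of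
    \<open>\<pi>\<close> by the \<open>2 ^ (p + q)\<close> blades.\<close>
  define avg where "avg v = mv_scale (1 / 2 ^ (p + q)) (\<Sum>A\<in>?P. mv_scale (1 / c A) (blade A \<odot> \<pi> (blade A \<odot> v)))" for v
  have avg_add: "avg (u + v) = avg u + avg v" for u v
    by (simp add: avg_def ga_mul_add_right \<pi>.add mv.scale_right_distrib sum.distrib)
  have avg_scale: "avg (mv_scale a v) = mv_scale a (avg v)" for a v
    by (simp add: avg_def ga_mul_scale_right \<pi>.scale mv.scale_sum_right mult.commute)
  let ?e = "avg ga_one"
  \<comment> \<open>\<open>ga p q 0\<close> serves only as the span of the blades without null
    index; \<open>\<odot>\<close> remains the product of the full algebra. The claim expresses that
    \<open>avg\<close> commutes with left multiplication by such elements.\<close>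
  have "v \<odot> ?e = avg v" if "v \<in> ga p q 0" for v
    using that
  proof (induction rule: ga_induct)
    case (blade B)
    then have B: "B \<in> ?P" by simp
    have "(\<Sum>A\<in>?P. mv_scale (1 / c A) (blade B \<odot> (blade A \<odot> \<pi> (blade A)))) =
        (\<Sum>A\<in>?P. mv_scale (1 / c A) (blade A \<odot> \<pi> (blade A \<odot> blade B)))"
    proof (rule sum.reindex_bij_witness[of _ "\<lambda>A. sym_diff A B" "\<lambda>A. sym_diff A B"])
      fix A assume A: "A \<in> ?P"
      define C where "C = sym_diff A B"
      have C: "C \<in> ?P" using A B by (auto simp: C_def)
      have fin: "finite A" "finite B" "finite C"
        by (rule finite_idx_subset, rule sub, fact)+
      have eqs: "sym_diff C B = A" "sym_diff B A = C" "sym_diff B C = A" by (auto simp: C_def)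
      \<comment> \<open>The cocycle identity compares the scalars on both sides of the reindexing of
        \<open>A\<close> by \<open>sym_diff A B\<close>.\<close>
      have co: "ga_coef p q r C B * c A = ga_coef p q r B A * c C"
        using ga_coef_cocycle[OF fin(3,2,1), of p q r, where 'f='f] unfolding eqs c_def .
      have \<pi>A: "\<pi> (blade A) \<in> alg" using \<pi>(1) Jalg by auto
      have "mv_scale (1 / c C) (blade C \<odot> \<pi> (blade C \<odot> blade B)) =
          mv_scale (ga_coef p q r C B / c C) (blade C \<odot> \<pi> (blade A))"
        using sub[OF C] sub[OF B] by (simp add: blade_mul eqs \<pi>.scale ga_mul_scale_right)
      also have "ga_coef p q r C B / c C = ga_coef p q r B A / c A"
        using co c[OF A] c[OF C] by (simp add: field_simps)
      also have "mv_scale (ga_coef p q r B A / c A) (blade C \<odot> \<pi> (blade A)) =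
          mv_scale (1 / c A) (blade B \<odot> blade A \<odot> \<pi> (blade A))"
        using sub[OF A] sub[OF B] by (simp add: blade_mul eqs ga_mul_scale_left)
      also have "blade B \<odot> blade A \<odot> \<pi> (blade A) = blade B \<odot> (blade A \<odot> \<pi> (blade A))"
        using sub[OF A] sub[OF B] \<pi>A by (intro mul_assoc blade_in_ga)
      finally show "mv_scale (1 / c (sym_diff A B)) (blade (sym_diff A B) \<odot> \<pi> (blade (sym_diff A B) \<odot> blade B)) =
          mv_scale (1 / c A) (blade B \<odot> (blade A \<odot> \<pi> (blade A)))"
        unfolding C_def .
    qed (use B in auto)
    moreover have "?e = mv_scale (1 / 2 ^ (p + q)) (\<Sum>A\<in>?P. mv_scale (1 / c A) (blade A \<odot> \<pi> (blade A)))"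
      unfolding avg_def
    proof (rule arg_cong[of _ _ "mv_scale _"], rule sum.cong[OF refl])
      fix A assume "A \<in> ?P"
      then have "(blade A :: 'f mv) \<odot> ga_one = blade A" using sub by (simp add: blade_in_ga)
      then show "mv_scale (1 / c A) (blade A \<odot> \<pi> (blade A \<odot> ga_one)) = mv_scale (1 / c A) (blade A \<odot> \<pi> (blade A))"
        by (simp only:)
    qed
    ultimately show ?case
      by (simp add: avg_def[of "blade B"] ga_mul_scale_right ga_mul_sum_right)
  qed (simp_all only: avg_add avg_scale ga_mul_add_left ga_mul_scale_left)
  moreover have "v \<in> ga p q 0" if "v \<in> J" for v
    using that J(2) by (auto simp: ga_eq_supported_on)
  moreover have "avg v = v" if v: "v \<in> J" for v
  proof -
    have "(\<Sum>A\<in>?P. mv_scale (1 / c A) (blade A \<odot> \<pi> (blade A \<odot> v))) = (\<Sum>A\<in>?P. v)"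
    proof (intro sum.cong refl)
      fix A assume A: "A \<in> ?P"
      have va: "v \<in> alg" using v Jalg by auto
      have "blade A \<odot> \<pi> (blade A \<odot> v) = blade A \<odot> (blade A \<odot> v)"
        using A v by (simp add: \<pi>(3) mul)
      also have "\<dots> = blade A \<odot> blade A \<odot> v"
        using sub[OF A] va by (intro mul_assoc[symmetric] blade_in_ga)
      also have "\<dots> = mv_scale (c A) v"
        using sub[OF A] va by (simp add: blade_mul c_def ga_mul_scale_left)
      finally show "mv_scale (1 / c A) (blade A \<odot> \<pi> (blade A \<odot> v)) = v"
        using c[OF A] by simp
    qed
    also have "\<dots> = (\<Sum>A\<in>?P. mv_scale 1 v)" by (simp only: mv.scale_one)
    also have "\<dots> = mv_scale (\<Sum>A\<in>?P. 1) v" by (rule mv.scale_sum_left[symmetric])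
    also have "(\<Sum>A\<in>?P. 1 :: 'f) = 2 ^ (p + q)" by (simp add: card_Pow)
    finally show ?thesis by (simp add: avg_def)
  qed
  moreover have "?e \<in> J"
    unfolding avg_def
    by (intro mv.subspace_scale[OF J(1)] mv.subspace_sum[OF J(1)] mul) (use \<pi>(1) in auto)
  ultimately show thesis using that by metis
qed

text \<open>What remains is that the part \<open>?J\<close> of the radical without null indices
  vanishes. Its right unit \<open>e\<close> is idempotent and lies in every maximal left ideal, so a
  maximal left ideal above \<open>?Q\<close> would contain the identity; hence \<open>?Q\<close> is
  everything. Thus \<open>ga_one - e\<close> is an idempotent with a left inverse, so it equals
  \<open>ga_one\<close>, and \<open>e = 0\<close> kills \<open>?J\<close>.\<close>

lemma rad_eq_supported_on:
  "ga_rad p q r = (null_ideal :: 'f::real_or_complex mv set)"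
proof (intro equalityI null_ideal_subset_rad subsetI)
  fix x :: "'f mv" assume x: "x \<in> ga_rad p q r"
  let ?J = "ga_rad p q r \<inter> supported_on (Pow {1..p+q}) :: 'f mv set"
  have rad: "mv.subspace (ga_rad p q r :: 'f mv set)" "ga_rad p q r \<subseteq> (alg :: 'f mv set)"
    using left_ideal_subspace[OF left_ideal_rad] by (auto simp: ga_rad_def)
  have "blade A \<odot> U \<in> ?J" if A: "A \<subseteq> {1..p+q}" and U: "U \<in> ?J" for A and U :: "'f mv"
  proof -
    have "blade A \<in> (supported_on (Pow {1..p+q}) :: 'f mv set)" using A by (simp add: blade_in_supported_on)
    then have "blade A \<odot> U \<in> supported_on (Pow {1..p+q})"
      using U by (elim ga_mul_in_supported_on) auto
    moreover have "(blade A :: 'f mv) \<in> alg" using A by (intro blade_in_ga) auto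
    ultimately show ?thesis using left_ideal_rad U unfolding ga_left_ideal_def by blast
  qed
  then obtain e where e: "e \<in> ?J" "\<And>v. v \<in> ?J \<Longrightarrow> v \<odot> e = v"
    using right_unit_of_nondegenerate_left_ideal[of ?J]
    by (metis (no_types, lifting) inf_le2 mv.subspace_inter rad(1) subspace_supported_on)
  have ealg: "e \<in> alg" using e(1) rad(2) by auto
  let ?Q = "(\<lambda>U. U \<odot> (ga_one - e)) ` alg"
  have Q: "ga_left_ideal p q r ?Q"
    unfolding ga_left_ideal_def
  proof (intro conjI ballI)
    show "0 \<in> ?Q" by (rule image_eqI[of _ _ 0]) (auto simp: ga_mul_zero_left)
    fix U V assume "U \<in> ?Q" "V \<in> ?Q"
    then show "U + V \<in> ?Q" by (auto simp flip: ga_mul_add_left)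
  next
    fix U V :: "'f mv" assume "U \<in> alg" "V \<in> ?Q"
    then show "U \<odot> V \<in> ?Q" using ealg by (auto simp flip: mul_assoc)
  qed auto
  have "ga_one \<in> ?Q"
  proof (rule ccontr)
    assume "ga_one \<notin> ?Q"
    then obtain M where M: "ga_maximal_left_ideal p q r M" "?Q \<subseteq> M"
      using maximal_left_ideal_exists[OF Q] by blast
    have "ga_one \<odot> (ga_one - e) \<in> ?Q" by simp
    then have "ga_one \<odot> (ga_one - e) \<in> M" using M(2) by (rule subsetD[rotated])
    then have "ga_one - e \<in> M" using ealg by simp
    moreover have "e \<in> M" using e(1) M(1) by (auto simp: ga_rad_def)
    moreover have ideal: "ga_left_ideal p q r M" "M \<noteq> alg" using M(1) by (auto simp: ga_maximal_left_ideal_def)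
    ultimately have "(ga_one - e) + e \<in> M" by (intro mv.subspace_add left_ideal_subspace)
    then show False using left_ideal_eq_alg[OF ideal(1)] ideal(2) by simp
  qed
  then obtain y where y: "ga_one = y \<odot> (ga_one - e)" "y \<in> alg" by (rule imageE)
  have "(ga_one - e) \<odot> (ga_one - e) = ga_one - e"
    using ealg e by (simp add: ga_mul_diff_left ga_mul_diff_right)
  then have "ga_one - e = ga_one"
    using y(2) ealg mul_assoc[of y "ga_one - e" "ga_one - e"] by (simp flip: y(1))
  then have "e = 0" by simp
  then have J0: "v = 0" if "v \<in> ?J" for v using e(2)[OF that] by (simp add: ga_mul_zero_right)
  have "x \<in> supported_on ({A. A \<subseteq> idx \<and> A \<inter> null \<noteq> {}} \<union> Pow {1..p+q})"
    using x rad(2) by (force simp: ga_def supported_on_def)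
  then obtain y z where yz: "y \<in> null_ideal" "z \<in> supported_on (Pow {1..p+q})" "x = y + z"
    by (rule supported_on_decomp)
  then have "z = x - y" by simp
  also have "\<dots> \<in> ga_rad p q r"
    using x yz(1) null_ideal_subset_rad by (intro mv.subspace_diff rad) auto
  finally have "z = 0" using J0 yz(2) by blast
  then show "x \<in> null_ideal" using yz by simp
qed

end

section \<open>The Lie algebras of the groups\<close>

context geometric_algebra
begin

section \<open>Unit groups and their products\<close>

lemma units_mono: "S \<subseteq> T \<Longrightarrow> units S \<subseteq> units T"
  by (auto simp: ga_units_def)

lemma units_mul:
  assumes "U \<in> units alg" "V \<in> units alg"
  shows "U \<odot> V \<in> units alg"
  using assms is_inverse_mul[of U V] by (auto simp: ga_units_def)

lemma Ppm_subset_units: "grp_Ppm p q r \<subseteq> units alg"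
  by (auto simp: grp_Ppm_def ga_units_def ga_par_def)

lemma one_plus_small_in_units:
  fixes X :: "'f::real_or_complex mv"
  assumes S: "mv.subspace S" "ga_one \<in> S" "S \<subseteq> alg" and X: "X \<in> S"
  shows "\<exists>\<epsilon>>0. \<forall>t. \<bar>t\<bar> < \<epsilon> \<longrightarrow> ga_one + mv_scale (of_real t) X \<in> units S"
proof (intro exI conjI allI impI)
  have pos: "1 + mv_norm X > 0" using mv_norm_nonneg[of X] by linarith
  \<comment> \<open>The added \<open>1\<close> keeps the radius positive when
    \<open>X = 0\<close>.\<close>
  then show "1 / (1 + mv_norm X) > 0" by simp
  fix t :: real assume "\<bar>t\<bar> < 1 / (1 + mv_norm X)"
  then have "\<bar>t\<bar> * (1 + mv_norm X) < 1" using pos by (simp add: pos_less_divide_eq)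
  moreover have "\<bar>t\<bar> * mv_norm X \<le> \<bar>t\<bar> * (1 + mv_norm X)" by (intro mult_left_mono) auto
  ultimately have "norm (of_real t :: 'f) * mv_norm X < 1" by simp
  then have "\<exists>V. is_inv (ga_one + mv_scale (of_real t) X) V"
    by (intro inverse_one_plus_small) (use S X in auto)
  moreover have "ga_one + mv_scale (of_real t) X \<in> S"
    by (intro mv.subspace_add mv.subspace_scale S X)
  ultimately show "ga_one + mv_scale (of_real t) X \<in> units S" by (simp add: ga_units_def)
qed

text \<open>Three factors cover all groups: an even one for \<open>X\<close> and one for each of the
  subspaces \<open>S\<close> and \<open>T\<close>. A group with fewer factors puts scalars with
  velocity \<open>0\<close> in an idle place.\<close>

lemma triple_product_in_lie_algebra:
  fixes H :: "'f::real_or_complex mv set"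
  assumes X: "X \<in> ga_par p q r 0"
    and S: "mv.subspace S" "ga_one \<in> S" "S \<subseteq> alg" "Y \<in> S"
    and T: "mv.subspace T" "ga_one \<in> T" "T \<subseteq> alg" "Z \<in> T"
    and H: "\<And>U V W. U \<in> grp_Ppm p q r \<Longrightarrow> V \<in> units S \<Longrightarrow> W \<in> units T \<Longrightarrow> U \<odot> V \<odot> W \<in> H"
  shows "X + Y + Z \<in> lie_algebra H"
proof -
  have even: "mv.subspace (ga_par p q r 0 :: 'f mv set)" "ga_one \<in> (ga_par p q r 0 :: 'f mv set)"
      "ga_par p q r 0 \<subseteq> (alg :: 'f mv set)"
    unfolding ga_par_eq_supported_on ga_eq_supported_on
    by (rule subspace_supported_on, rule blade_in_supported_on, simp, rule supported_on_mono, auto)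
  obtain a where a: "a > 0" "\<And>t. \<bar>t\<bar> < a \<Longrightarrow> ga_one + mv_scale (of_real t) X \<in> units (ga_par p q r 0)"
    using one_plus_small_in_units[OF even X] by blast
  obtain b where b: "b > 0" "\<And>t. \<bar>t\<bar> < b \<Longrightarrow> ga_one + mv_scale (of_real t) Y \<in> units S"
    using one_plus_small_in_units[OF S] by blast
  obtain c where c: "c > 0" "\<And>t. \<bar>t\<bar> < c \<Longrightarrow> ga_one + mv_scale (of_real t) Z \<in> units T"
    using one_plus_small_in_units[OF T] by blast
  show ?thesis
  proof (rule product_curve_in_lie_algebra[of _ _ _ "min a (min b c)"])
    fix t :: real assume "\<bar>t\<bar> < min a (min b c)"
    then show "(ga_one + mv_scale (of_real t) X) \<odot> (ga_one + mv_scale (of_real t) Y) \<odot>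
        (ga_one + mv_scale (of_real t) Z) \<in> H"
      by (intro H a(2) b(2) c(2)) (use a(2)[of t] in \<open>auto simp: grp_Ppm_def\<close>)
  qed (use even X S T a(1) b(1) c(1) in auto)
qed

text \<open>Nonzero scalars preserve parity, so a scalar factor is absorbed. This is what makes idle
  factors in \<open>triple_product_in_lie_algebra\<close> harmless.\<close>

lemma Ppm_mul_scalar:
  assumes U: "U \<in> grp_Ppm p q r" and V: "V \<in> units (supported_on {{}})"
  shows "U \<odot> V \<in> grp_Ppm p q r"
proof -
  have "V = mv_scale (V {}) ga_one"
    using V by (auto simp: ga_units_def supported_on_def mv_scale_def blade_def)
  moreover have U': "U \<in> units alg" using U Ppm_subset_units by auto
  ultimately have eq: "U \<odot> V = mv_scale (V {}) U"
    by (metis (no_types, lifting) ga_mul_scale_right ga_units_def mem_Collect_eq mul_one(2))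
  have "V \<in> units alg"
    by (rule subsetD[OF units_mono V]) (auto simp: ga_eq_supported_on supported_on_def)
  then have "\<exists>W. is_inv (U \<odot> V) W" using units_mul[OF U'] by (auto simp: ga_units_def)
  then show ?thesis
    using U unfolding eq
    by (auto simp: grp_Ppm_def ga_units_def ga_par_eq_supported_on intro: mv.subspace_scale[OF subspace_supported_on])
qed

lemma grade_inv_grp_mul:
  fixes U :: "'f::real_or_complex mv"
  assumes U: "U \<in> grp_Ppm p q r" and S: "subalgebra (supported_on F :: 'f mv set)" and V: "V \<in> units (supported_on F)"
  shows "\<exists>W\<in>supported_on F. W \<in> alg \<and> grade_inv (U \<odot> V) = U \<odot> V \<odot> W"
proof -
  obtain k where "U \<in> ga_par p q r k" using U by (auto simp: grp_Ppm_def ga_units_def)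
  then have Ua: "U \<in> alg" and gU: "grade_inv U = mv_scale ((-1) ^ k) U" by (auto simp: ga_par_def)
  obtain V' where V': "is_inv V V'" and VF: "V \<in> supported_on F" using V by (auto simp: ga_units_def)
  have V'F: "V' \<in> supported_on F" by (rule inverse_in_subalgebra[OF S VF V'])
  have Fa: "supported_on F \<subseteq> (alg :: 'f mv set)" using S by (simp add: ga_subalgebra_def)
  have gV: "grade_inv V \<in> supported_on F" using VF by (auto simp: supported_on_def grade_inv_def)
  let ?W = "mv_scale ((-1) ^ k) (V' \<odot> grade_inv V)"
  have "?W \<in> supported_on F"
    using S V'F gV by (auto simp: ga_subalgebra_def intro: mv.subspace_scale)
  moreover have "grade_inv (U \<odot> V) = U \<odot> V \<odot> ?W"
  proof -
    have *: "V \<in> alg" "V' \<in> alg" "grade_inv V \<in> alg" using VF V'F gV Fa by auto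
    have "U \<odot> V \<odot> (V' \<odot> grade_inv V) = U \<odot> ((V \<odot> V') \<odot> grade_inv V)"
      using Ua * by (simp only: mul_assoc mul_in_alg)
    also have "\<dots> = U \<odot> grade_inv V" using V' *(3) by (simp add: ga_is_inverse_def)
    finally show ?thesis
      by (simp add: grade_inv_automorphism(3) gU ga_mul_scale_left ga_mul_scale_right)
  qed
  ultimately show ?thesis using Fa by blast
qed

section \<open>Commutators and the index families closed under them\<close>

lemma commutator_nth:
  fixes X Y :: "'f::real_or_complex mv"
  shows "ga_commutator p q r X Y C = (\<Sum>A\<in>Pow idx. \<Sum>B\<in>Pow idx.
    if C = sym_diff A B then X A * Y B * (ga_coef p q r A B - ga_coef p q r B A) else 0)"
proof -
  have "(Y \<odot> X) C = (\<Sum>A\<in>Pow idx. \<Sum>B\<in>Pow idx.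
      if C = sym_diff A B then X A * Y B * ga_coef p q r B A else 0)"
    unfolding ga_mul_apply
    by (subst sum.swap, intro sum.cong refl) (simp add: Un_commute mult.commute)
  then have "ga_commutator p q r X Y C = (\<Sum>A\<in>Pow idx. \<Sum>B\<in>Pow idx.
      (if C = sym_diff A B then X A * Y B * ga_coef p q r A B else 0) -
      (if C = sym_diff A B then X A * Y B * ga_coef p q r B A else 0))"
    by (simp only: ga_commutator_def minus_apply ga_mul_apply[of _ _ _ X Y] sum_subtractf)
  also have "\<dots> = (\<Sum>A\<in>Pow idx. \<Sum>B\<in>Pow idx.
      if C = sym_diff A B then X A * Y B * (ga_coef p q r A B - ga_coef p q r B A) else 0)"
    by (intro sum.cong refl) (simp add: algebra_simps)
  finally show ?thesis .
qed

text \<open>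
  For even \<open>card A\<close>, the basis elements of \<open>A\<close> and \<open>B\<close> fail to commute exactly when \<open>A \<inter> B\<close> contains
  no null index and has odd cardinality; hence the last condition makes the even elements together
  with those supported on \<open>F\<close> closed under commutators.
\<close>

definition parity_extension :: "nat set set \<Rightarrow> bool" where
  "parity_extension F \<longleftrightarrow> F \<subseteq> Pow idx \<and> {} \<in> F \<and>
    (\<forall>A\<in>F. \<forall>B\<in>F. A \<inter> B \<subseteq> {..p+q} \<longrightarrow> sym_diff A B \<in> F) \<and>
    (\<forall>A B. A \<subseteq> idx \<longrightarrow> B \<in> F \<longrightarrow> even (card A) \<longrightarrow> odd (card B) \<longrightarrow>
      odd (card (A \<inter> B)) \<longrightarrow> A \<inter> B \<subseteq> {..p+q} \<longrightarrow> sym_diff A B \<in> F)"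

lemma parity_extensionD:
  assumes "parity_extension F"
  shows "A \<in> F \<Longrightarrow> A \<subseteq> idx" and "{} \<in> F"
    and "A \<in> F \<Longrightarrow> B \<in> F \<Longrightarrow> A \<inter> B \<subseteq> {..p+q} \<Longrightarrow> sym_diff A B \<in> F"
    and "A \<subseteq> idx \<Longrightarrow> B \<in> F \<Longrightarrow> even (card A) \<Longrightarrow> odd (card B) \<Longrightarrow>
      odd (card (A \<inter> B)) \<Longrightarrow> A \<inter> B \<subseteq> {..p+q} \<Longrightarrow> sym_diff A B \<in> F"
  using assms unfolding parity_extension_def by (blast, blast, simp, simp)

abbreviation even_or_in :: "nat set set \<Rightarrow> nat set set" where
  "even_or_in F \<equiv> {A. A \<subseteq> idx \<and> (even (card A) \<or> A \<in> F)}"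

text \<open>Only odd sets \<open>C\<close> outside \<open>F\<close> are at stake, and an odd
  symmetric difference comes from one even and one odd set, the odd one being in \<open>F\<close>.
  If the two blades commute, their contribution cancels; otherwise the last condition of
  \<open>parity_extension\<close> puts \<open>C\<close> into \<open>F\<close>.\<close>

lemma commutator_in_supported_on:
  fixes X Y :: "'f::real_or_complex mv"
  assumes F: "parity_extension F"
    and XY: "X \<in> supported_on (even_or_in F)" "Y \<in> supported_on (even_or_in F)"
  shows "ga_commutator p q r X Y \<in> supported_on (even_or_in F)"
  unfolding supported_on_def
proof (intro CollectI allI impI)
  fix C assume C: "C \<notin> even_or_in F"
  have mixed: "sym_diff A B \<in> F"
    if "A \<subseteq> idx" "B \<in> F" "even (card A)" "odd (card B)"
      "ga_coef p q r A B \<noteq> (ga_coef p q r B A :: 'f)" for A B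
  proof -
    have fin: "finite A" "finite B"
      using that(1) parity_extensionD(1)[OF F that(2)] by (blast intro: finite_idx_subset)+
    have "odd (card (A \<inter> B))"
      using that(3,5) ga_coef_swap[OF fin, of p q r, where 'f='f] by auto
    moreover have "A \<inter> B \<subseteq> {..p+q}"
      using that(5) ga_coef_eq_0_iff[OF fin(1), of p q r B, where 'f='f]
        ga_coef_eq_0_iff[OF fin(2), of p q r A, where 'f='f] by (auto simp: Int_commute)
    ultimately show ?thesis using parity_extensionD(4)[OF F that(1-4)] by simp
  qed
  have "X A * Y B * (ga_coef p q r A B - ga_coef p q r B A) = 0"
    if AB: "A \<subseteq> idx" "B \<subseteq> idx" "C = sym_diff A B" for A B
  proof (rule ccontr)
    assume ne: "\<not> ?thesis"
    have C': "odd (card C)" "C \<notin> F" using C AB by auto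
    have A: "even (card A) \<or> A \<in> F" and B: "even (card B) \<or> B \<in> F"
      using ne XY by (auto simp: supported_on_def)
    have co: "ga_coef p q r A B \<noteq> (ga_coef p q r B A :: 'f)" using ne by auto
    have "even (card A) \<noteq> even (card B)"
      using C'(1) AB even_card_sym_diff[of A B] finite_idx_subset by auto
    then consider "even (card A)" "odd (card B)" | "even (card B)" "odd (card A)" by auto
    then show False
    proof cases
      case 1
      then show False using mixed[OF AB(1) _ 1 co] B C'(2) AB(3) by auto
    next
      case 2
      then have "sym_diff B A \<in> F" using mixed[OF AB(2) _ 2 co[symmetric]] A by auto
      then show False using C'(2) AB(3) by (simp add: Un_commute)
    qed
  qed
  then show "ga_commutator p q r X Y C = 0"
    unfolding commutator_nth by (intro sum.neutral ballI) auto
qed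

definition has_lie_algebra :: "'f::real_or_complex mv set \<Rightarrow> nat set set \<Rightarrow> bool" where
  "has_lie_algebra H G \<longleftrightarrow> lie_algebra H = supported_on G \<and> mv.subspace (lie_algebra H) \<and>
    (\<forall>X\<in>lie_algebra H. \<forall>Y\<in>lie_algebra H. ga_commutator p q r X Y \<in> lie_algebra H \<and>
      is_lie_bracket p q r H X Y (ga_commutator p q r X Y))"

text \<open>The premise \<open>lower\<close> speaks of the odd members of \<open>F\<close> only,
  since the even ones are covered by \<open>ga_par p q r 0\<close>. So the second factor of
  \<open>H\<close> has to be known only up to even elements.\<close>

lemma has_lie_algebra_of_parity_extension:
  fixes H :: "'f::real_or_complex mv set"
  assumes F: "parity_extension F"
    and H: "\<And>T. T \<in> H \<Longrightarrow> \<exists>U\<in>grp_Ppm p q r. \<exists>V\<in>units (supported_on F). T = U \<odot> V"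
    and lower: "\<And>X Y. X \<in> ga_par p q r 0 \<Longrightarrow> Y \<in> supported_on {A \<in> F. odd (card A)} \<Longrightarrow> X + Y \<in> lie_algebra H"
  shows "has_lie_algebra H (even_or_in F)"
proof -
  have S: "subalgebra (supported_on F :: 'f mv set)"
    by (rule subalgebra_supported_on) (use parity_extensionD(1-3)[OF F] in auto)
  then have Fa: "supported_on F \<subseteq> (alg :: 'f mv set)" by (simp add: ga_subalgebra_def)
  have Hu: "H \<subseteq> units alg"
  proof
    fix T assume "T \<in> H"
    then obtain U V where UV: "U \<in> grp_Ppm p q r" "V \<in> units (supported_on F)" "T = U \<odot> V" using H by blast
    show "T \<in> units alg"
      unfolding UV(3)
      by (intro units_mul subsetD[OF Ppm_subset_units UV(1)] subsetD[OF units_mono[OF Fa] UV(2)])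
  qed
  have "lie_algebra H \<subseteq> supported_on (even_or_in F)"
  proof (rule lie_algebra_subset_supported_on[OF Hu])
    show "{} \<in> F" using F by (simp add: parity_extension_def)
    fix T assume "T \<in> H"
    then show "\<exists>W\<in>supported_on F. W \<in> alg \<and> grade_inv T = T \<odot> W"
      using H grade_inv_grp_mul[OF _ S] by blast
  qed
  moreover have "supported_on (even_or_in F) \<subseteq> lie_algebra H"
  proof
    fix X :: "'f mv" assume "X \<in> supported_on (even_or_in F)"
    also have "even_or_in F = {A. A \<subseteq> idx \<and> (even (card A) \<longleftrightarrow> even 0)} \<union> {A \<in> F. odd (card A)}"
      using parity_extensionD(1)[OF F] by auto
    finally obtain Y Z where "Y \<in> ga_par p q r 0" "Z \<in> supported_on {A \<in> F. odd (card A)}" "X = Y + Z"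
      unfolding ga_par_eq_supported_on by (rule supported_on_decomp)
    then show "X \<in> lie_algebra H" using lower by simp
  qed
  ultimately have eq: "lie_algebra H = supported_on (even_or_in F)" by (rule equalityI)
  show ?thesis
    unfolding has_lie_algebra_def
  proof (intro conjI ballI)
    show "mv.subspace (lie_algebra H)" unfolding eq by (rule subspace_supported_on)
    fix X Y assume XY: "X \<in> lie_algebra H" "Y \<in> lie_algebra H"
    have "Y \<in> alg" using XY(2) unfolding eq by (auto simp: ga_def supported_on_def)
    then show "is_lie_bracket p q r H X Y (ga_commutator p q r X Y)"
      by (rule is_lie_bracket_commutator[OF Hu XY(1)])
    show "ga_commutator p q r X Y \<in> lie_algebra H"
      using commutator_in_supported_on[OF F] XY unfolding eq by simp
  qed (rule eq)
qed

section \<open>Index families for the five groups\<close>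

lemma parity_extension_scalars: "parity_extension {{}}"
  by (auto simp: parity_extension_def)

lemma parity_extension_null: "parity_extension (Pow null)"
proof -
  have "A \<inter> B = {}" if "B \<subseteq> null" "A \<inter> B \<subseteq> {..p+q}" for A B using that by fastforce
  then show ?thesis
    unfolding parity_extension_def by (auto simp: subset_iff)
qed

text \<open>A null index of one set survives in the symmetric difference unless it is shared. The
  only member without null indices is the empty set, which is not odd.\<close>

lemma parity_extension_null_ideal: "parity_extension ({{}} \<union> {A. A \<subseteq> idx \<and> A \<inter> null \<noteq> {}})"
proof -
  have "sym_diff A B \<in> {{}} \<union> {A. A \<subseteq> idx \<and> A \<inter> null \<noteq> {}}"
    if "A \<subseteq> idx" "B \<subseteq> idx" "A \<inter> B \<subseteq> {..p+q}" "A \<inter> null \<noteq> {} \<or> B \<inter> null \<noteq> {}" for A B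
  proof -
    have "sym_diff A B \<subseteq> idx" using that(1,2) by blast
    moreover have "sym_diff A B \<inter> null \<noteq> {}" unfolding sym_diff_Int_null[OF that(1,3)] using that(4) by blast
    ultimately show ?thesis by simp
  qed
  note * = this
  show ?thesis
    unfolding parity_extension_def
  proof (intro conjI ballI allI impI)
    fix A B assume A: "A \<in> {{}} \<union> {A. A \<subseteq> idx \<and> A \<inter> null \<noteq> {}}"
      and B: "B \<in> {{}} \<union> {A. A \<subseteq> idx \<and> A \<inter> null \<noteq> {}}" and AB: "A \<inter> B \<subseteq> {..p+q}"
    show "sym_diff A B \<in> {{}} \<union> {A. A \<subseteq> idx \<and> A \<inter> null \<noteq> {}}"
    proof (cases "A = {} \<and> B = {}")
      case False
      then show ?thesis by (intro *) (use A B AB in blast)+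
    qed simp
  next
    fix A B assume A: "A \<subseteq> idx" and B: "B \<in> {{}} \<union> {A. A \<subseteq> idx \<and> A \<inter> null \<noteq> {}}"
      and "odd (card B)" and AB: "A \<inter> B \<subseteq> {..p+q}"
    then have "B \<noteq> {}" by auto
    then show "sym_diff A B \<in> {{}} \<union> {A. A \<subseteq> idx \<and> A \<inter> null \<noteq> {}}"
      by (intro *) (use A B AB in blast)+
  qed auto
qed

text \<open>A nonempty member of \<open>G\<close> shares a null index with \<open>idx\<close>, so
  their blades multiply to zero. In the commutator condition \<open>B = idx\<close> would make
  \<open>A \<inter> B = A\<close> both even and odd.\<close>

lemma parity_extension_top:
  assumes G: "G \<subseteq> Pow null" "{} \<in> G"
    and mul: "\<And>A B. A \<in> G \<Longrightarrow> B \<in> G \<Longrightarrow> A \<inter> B = {} \<Longrightarrow> A \<union> B \<in> G"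
  shows "parity_extension (G \<union> {A. A = idx \<and> odd (card A)})"
  unfolding parity_extension_def
proof (intro conjI ballI allI impI)
  have disj: "A \<inter> B = {}" if "A \<in> G" "A \<inter> B \<subseteq> {..p+q}" for A B using that G by fastforce
  {
    fix A B assume A: "A \<in> G \<union> {A. A = idx \<and> odd (card A)}" and B: "B \<in> G \<union> {A. A = idx \<and> odd (card A)}"
      and AB: "A \<inter> B \<subseteq> {..p+q}"
    have sub: "A' \<subseteq> idx" if "A' \<in> G" for A' using that G(1) by fastforce
    have AG: "A \<inter> B = {}" if "A \<in> G \<or> B \<in> G" using that AB disj[of A B] disj[of B A] by (auto simp: Int_commute)
    consider "A \<in> G" "B \<in> G" | "A \<in> G" "B = idx" "odd (card idx)" | "A = idx" "B \<in> G" "odd (card idx)" | "A = idx" "B = idx"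
      using A B by auto
    then show "sym_diff A B \<in> G \<union> {A. A = idx \<and> odd (card A)}"
    proof cases
      case 1
      then show ?thesis using mul AG by (simp add: Diff_triv Int_commute)
    next
      case 2
      then have "A = {}" using AG sub[of A] by auto
      then show ?thesis using 2 by auto
    next
      case 3
      then have "B = {}" using AG sub[of B] by auto
      then show ?thesis using 3 by auto
    next
      case 4
      then show ?thesis using G(2) by simp
    qed
  next
    fix A B assume A: "A \<subseteq> idx" "B \<in> G \<union> {A. A = idx \<and> odd (card A)}" "even (card A)" "odd (card (A \<inter> B))"
      "A \<inter> B \<subseteq> {..p+q}"
    have "B \<notin> G" using disj[of B A] A by (auto simp: Int_commute)
    moreover have "B \<noteq> idx" using A by (auto simp: Int_absorb2)
    ultimately show "sym_diff A B \<in> G \<union> {A. A = idx \<and> odd (card A)}" using A by auto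
  }
qed (use G in fastforce)+

lemma scalars:
  "mv.subspace (supported_on {{}} :: 'f::real_or_complex mv set)"
  "ga_one \<in> (supported_on {{}} :: 'f mv set)"
  "supported_on {{}} \<subseteq> (alg :: 'f mv set)"
  "0 \<in> (supported_on {{}} :: 'f mv set)"
  by (rule subspace_supported_on) (auto simp: supported_on_def blade_def ga_def)

section \<open>The five groups\<close>

lemma has_lie_algebra_Ppm:
  "has_lie_algebra (grp_Ppm p q r :: 'f::real_or_complex mv set) (even_or_in {{}})"
proof (rule has_lie_algebra_of_parity_extension[OF parity_extension_scalars])
  fix T :: "'f mv" assume T: "T \<in> grp_Ppm p q r"
  have "is_inv (ga_one :: 'f mv) ga_one" by (simp add: ga_is_inverse_def)
  then have "ga_one \<in> units (supported_on {{}} :: 'f mv set)"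
    unfolding ga_units_def using scalars(2) by blast
  moreover have "T = T \<odot> ga_one" using T Ppm_subset_units by (auto simp: ga_units_def)
  ultimately show "\<exists>U\<in>grp_Ppm p q r. \<exists>V\<in>units (supported_on {{}}). T = U \<odot> V" using T by blast
next
  fix X Y :: "'f mv" assume X: "X \<in> ga_par p q r 0" and "Y \<in> supported_on {A \<in> {{}}. odd (card A)}"
  then have "Y = 0" by (auto simp: supported_on_def)
  moreover have "X + 0 + 0 \<in> lie_algebra (grp_Ppm p q r)"
    by (rule triple_product_in_lie_algebra[OF X scalars scalars]) (intro Ppm_mul_scalar)
  ultimately show "X + Y \<in> lie_algebra (grp_Ppm p q r)" by simp
qed

text \<open>The subspace \<open>S\<close> is merely squeezed between the odd part of
  \<open>supported_on F\<close> and all of it. This suits the center, which is controlled by just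
  these two inclusions.\<close>

lemma has_lie_algebra_product:
  fixes S :: "'f::real_or_complex mv set"
  assumes F: "parity_extension F"
    and S: "mv.subspace S" "ga_one \<in> S" "S \<subseteq> supported_on F" "supported_on {A \<in> F. odd (card A)} \<subseteq> S"
  shows "has_lie_algebra (ga_set_mul p q r (grp_Ppm p q r) (units S)) (even_or_in F)" (is "has_lie_algebra ?H _")
proof (rule has_lie_algebra_of_parity_extension[OF F])
  fix T assume "T \<in> ?H"
  then show "\<exists>U\<in>grp_Ppm p q r. \<exists>V\<in>units (supported_on F). T = U \<odot> V"
    using units_mono[OF S(3)] unfolding ga_set_mul_def by blast
next
  have Sa: "S \<subseteq> alg"
    using S(3) supported_on_mono[of F "Pow idx"] parity_extensionD(1)[OF F] unfolding ga_eq_supported_on by blast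
  fix X Y :: "'f mv" assume X: "X \<in> ga_par p q r 0" and Y: "Y \<in> supported_on {A \<in> F. odd (card A)}"
  have "X + 0 + Y \<in> lie_algebra ?H"
  proof (rule triple_product_in_lie_algebra[OF X scalars S(1,2) Sa subsetD[OF S(4) Y]])
    fix U V W :: "'f mv"
    assume "U \<in> grp_Ppm p q r" "V \<in> units (supported_on {{}})" "W \<in> units S"
    then show "U \<odot> V \<odot> W \<in> ?H" unfolding ga_set_mul_def using Ppm_mul_scalar by blast
  qed
  then show "X + Y \<in> lie_algebra ?H" by simp
qed

lemma has_lie_algebra_PpmLambda:
  "has_lie_algebra (grp_PpmLambda p q r :: 'f::real_or_complex mv set) (even_or_in (Pow null))"
  unfolding grp_PpmLambda_def grassmann_eq_supported_on
  by (intro has_lie_algebra_product parity_extension_null subspace_supported_on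
    blade_in_supported_on supported_on_mono) auto

lemma has_lie_algebra_Ppmrad:
  "has_lie_algebra (grp_Ppmrad p q r :: 'f::real_or_complex mv set)
    (even_or_in ({{}} \<union> {A. A \<subseteq> idx \<and> A \<inter> null \<noteq> {}}))"
proof -
  have "{A. A \<subseteq> idx \<and> card A = 0} = {{}}" using finite_idx_subset by auto
  then show ?thesis
    unfolding grp_Ppmrad_def rad_eq_supported_on grade_eq_supported_on mv_set_add_supported_on
    by (intro has_lie_algebra_product parity_extension_null_ideal subspace_supported_on
      blade_in_supported_on supported_on_mono) auto
qed

text \<open>This is \<open>{idx}\<close> for odd n and empty for even n, so that both parities are
  treated at once.\<close>

abbreviation top_odd :: "nat set set" where "top_odd \<equiv> {A. A = idx \<and> odd (card A)}"

lemma supported_on_top_odd_subset_center: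
  "(supported_on top_odd :: 'f::real_or_complex mv set) \<subseteq> ga_center p q r"
proof (cases "odd (p + q + r)")
  case True
  then have "top_odd = {idx}" by auto
  then show ?thesis using supported_on_idx_subset_center[OF True] by (simp only:)
next
  case False
  then have eq: "top_odd = {}" by auto
  have "(supported_on {} :: 'f mv set) \<subseteq> {0}" by (auto simp: supported_on_def)
  then show ?thesis unfolding eq using mv.subspace_0[OF subspace_center] by blast
qed

lemma has_lie_algebra_P:
  "has_lie_algebra (grp_P p q r :: 'f::real_or_complex mv set)
    (even_or_in ({A. A \<subseteq> null \<and> even (card A)} \<union> top_odd))"
  unfolding grp_P_def
proof (rule has_lie_algebra_product)
  show "parity_extension ({A. A \<subseteq> null \<and> even (card A)} \<union> top_odd)"
  proof (rule parity_extension_top)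
    fix A B assume A: "A \<in> {A. A \<subseteq> null \<and> even (card A)}" and B: "B \<in> {A. A \<subseteq> null \<and> even (card A)}"
      and "A \<inter> B = {}"
    moreover have "finite A" "finite B" using A B by (auto intro: finite_subset)
    ultimately show "A \<union> B \<in> {A. A \<subseteq> null \<and> even (card A)}" by (simp add: card_Un_disjoint)
  qed auto
  have "{A \<in> {A. A \<subseteq> null \<and> even (card A)} \<union> top_odd. odd (card A)} \<subseteq> top_odd" by auto
  then show "supported_on {A \<in> {A. A \<subseteq> null \<and> even (card A)} \<union> top_odd. odd (card A)} \<subseteq> (ga_center p q r :: 'f mv set)"
    by (rule subset_trans[OF supported_on_mono supported_on_top_odd_subset_center])
qed (rule subspace_center one_in_center center_subset_supported_on)+

text \<open>For the upper bound the central and the Grassmann factor merge into one unit of the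
  subalgebra on \<open>?F\<close>; for the lower bound they stay separate, and an odd element splits
  into a top and a null part. The two index families overlap when n = r is odd.\<close>

lemma has_lie_algebra_PLambda:
  "has_lie_algebra (grp_PLambda p q r :: 'f::real_or_complex mv set) (even_or_in (Pow null \<union> top_odd))"
proof -
  let ?F = "Pow null \<union> top_odd"
  have F: "parity_extension ?F" by (rule parity_extension_top) auto
  have S: "subalgebra (supported_on ?F :: 'f mv set)"
    by (rule subalgebra_supported_on) (use parity_extensionD(1-3)[OF F] in auto)
  then have Sa: "supported_on ?F \<subseteq> (alg :: 'f mv set)" by (simp add: ga_subalgebra_def)
  have center: "ga_center p q r \<subseteq> (supported_on ?F :: 'f mv set)"
    by (rule subset_trans[OF center_subset_supported_on supported_on_mono]) auto
  have grass: "grassmann p q r \<subseteq> (supported_on ?F :: 'f mv set)"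
    unfolding grassmann_eq_supported_on by (rule supported_on_mono) auto
  have gr: "mv.subspace (grassmann p q r :: 'f mv set)" "ga_one \<in> (grassmann p q r :: 'f mv set)"
    unfolding grassmann_eq_supported_on by (rule subspace_supported_on, rule blade_in_supported_on, simp)
  show ?thesis
  proof (rule has_lie_algebra_of_parity_extension[OF F])
    fix T :: "'f mv" assume "T \<in> grp_PLambda p q r"
    then obtain U Z V where U: "U \<in> grp_Ppm p q r" and Z: "Z \<in> units (ga_center p q r)"
      and V: "V \<in> units (grassmann p q r)" and T: "T = U \<odot> Z \<odot> V"
      unfolding grp_PLambda_def grp_P_def ga_set_mul_def by blast
    have ZF: "Z \<in> supported_on ?F" "V \<in> supported_on ?F"
      using Z V center grass unfolding ga_units_def by blast+
    have un: "U \<in> units alg" "Z \<in> units alg" "V \<in> units alg"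
      using U Ppm_subset_units units_mono[OF subset_trans[OF center Sa]] units_mono[OF subset_trans[OF grass Sa]] Z V
      by auto
    have "Z \<odot> V \<in> supported_on ?F" using S ZF by (simp only: ga_subalgebra_def)
    then have "Z \<odot> V \<in> units (supported_on ?F)"
      using units_mul[OF un(2,3)] unfolding ga_units_def by blast
    moreover have "T = U \<odot> (Z \<odot> V)"
      unfolding T by (rule mul_assoc) (use un in \<open>simp_all only: ga_units_def mem_Collect_eq\<close>)
    ultimately show "\<exists>U\<in>grp_Ppm p q r. \<exists>V\<in>units (supported_on ?F). T = U \<odot> V" using U by blast
  next
    fix X Y :: "'f mv" assume X: "X \<in> ga_par p q r 0" and "Y \<in> supported_on {A \<in> ?F. odd (card A)}"
    then have "Y \<in> supported_on (top_odd \<union> Pow null)"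
      using supported_on_mono[of "{A \<in> ?F. odd (card A)}" "top_odd \<union> Pow null"] by blast
    then obtain Z W where Z: "Z \<in> supported_on top_odd" and W: "W \<in> supported_on (Pow null)" and Y: "Y = Z + W"
      by (rule supported_on_decomp)
    have "X + Z + W \<in> lie_algebra (grp_PLambda p q r)"
    proof (rule triple_product_in_lie_algebra[OF X subspace_center one_in_center])
      show "ga_center p q r \<subseteq> (alg :: 'f mv set)" "grassmann p q r \<subseteq> (alg :: 'f mv set)"
        using center grass Sa by auto
      show "Z \<in> ga_center p q r" using Z supported_on_top_odd_subset_center by blast
      show "W \<in> grassmann p q r" using W by (simp only: grassmann_eq_supported_on)
    qed (auto simp: gr grp_PLambda_def grp_P_def ga_set_mul_def)
    then show "X + Y \<in> lie_algebra (grp_PLambda p q r)" by (simp add: Y add.assoc)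
  qed
qed

end

section \<open>Counting and the final statement\<close>

lemma supported_on_Int: "supported_on G \<inter> supported_on H = supported_on (G \<inter> H)"
  by (auto simp: supported_on_def)

text \<open>An odd subset of \<open>{1..m+k}\<close> either meets the last \<open>k\<close> indices
  or is an odd subset of \<open>{1..m}\<close>. The additive form avoids truncated subtraction; for
  \<open>m = 0\<close> there are no sets of the second kind.\<close>

lemma card_odd_subsets_meeting:
  assumes "0 < m + k"
  shows "card {A. A \<subseteq> {1..m+k} \<and> A \<inter> {m+1..m+k} \<noteq> {} \<and> odd (card A)} + (if m = 0 then 0 else 2 ^ (m - 1)) =
    (2 :: nat) ^ (m + k - 1)"
proof -
  let ?O = "\<lambda>N. {A :: nat set. A \<subseteq> N \<and> odd (card A)}"
  let ?M = "{A. A \<subseteq> {1..m+k} \<and> A \<inter> {m+1..m+k} \<noteq> {} \<and> odd (card A)}"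
  have "A \<subseteq> {1..m}" if "A \<subseteq> {1..m+k}" "A \<inter> {m+1..m+k} = {}" for A
    using that by fastforce
  then have "?O {1..m+k} = ?M \<union> ?O {1..m}" by fastforce
  then have "card (?O {1..m+k}) = card (?M \<union> ?O {1..m})" by simp
  also have "\<dots> = card ?M + card (?O {1..m})" by (rule card_Un_disjoint) (fastforce+)
  finally have "card ?M + card (?O {1..m}) = 2 ^ (m + k - 1)"
    using card_even_odd_subsets(2)[of "{1..m+k}"] assms by simp
  moreover have "card (?O {1..m}) = (if m = 0 then 0 else 2 ^ (m - 1))"
    using card_even_odd_subsets(2)[of "{1..m}"] by (simp add: card_eq_0_iff)
  ultimately show ?thesis by simp
qed

theorem theorem8p1:
  fixes p q r n :: nat
    and p_pm p_pmLambda p_pmrad p_P p_PLambda :: "'f::real_or_complex mv set"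
  assumes "n = p + q + r" and "n \<ge> 1"
    and "p_pm = lie_algebra (grp_Ppm p q r)"
    and "p_pmLambda = lie_algebra (grp_PpmLambda p q r)"
    and "p_pmrad = lie_algebra (grp_Ppmrad p q r)"
    and "p_P = lie_algebra (grp_P p q r)"
    and "p_PLambda = lie_algebra (grp_PLambda p q r)"
  shows
    "(\<forall>(H, L) \<in> {(grp_Ppm p q r, p_pm), (grp_PpmLambda p q r, p_pmLambda),
                  (grp_Ppmrad p q r, p_pmrad), (grp_P p q r, p_P), (grp_PLambda p q r, p_PLambda)}.
        mv.subspace L \<and>
        (\<forall>X\<in>L. \<forall>Y\<in>L. ga_commutator p q r X Y \<in> L \<and>
                        is_lie_bracket p q r H X Y (ga_commutator p q r X Y))) \<and>

     p_pm = ga_par p q r 0 \<and>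
     is_direct_sum p_pmLambda [ga_par p q r 0, grassmann_par p q r 1] \<and>
     is_direct_sum p_pmrad [ga_par p q r 0, ga_rad_par p q r 1] \<and>
     (odd n \<longrightarrow> is_direct_sum p_P [ga_par p q r 0, grade p q r n]) \<and>
     (even n \<longrightarrow> p_P = ga_par p q r 0) \<and>
     (odd n \<and> n \<noteq> r \<longrightarrow>
        is_direct_sum p_PLambda [ga_par p q r 0, grassmann_par p q r 1, grade p q r n]) \<and>
     (\<not> (odd n \<and> n \<noteq> r) \<longrightarrow>
        is_direct_sum p_PLambda [ga_par p q r 0, grassmann_par p q r 1]) \<and>

     mv.dim p_pm = 2 ^ (n - 1) \<and>
     mv.dim p_pmLambda = (if r \<ge> 1 then 2 ^ (n - 1) + 2 ^ (r - 1) else 2 ^ (n - 1)) \<and>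
     mv.dim p_pmrad = (if p + q \<ge> 1 then 2 ^ n - 2 ^ (p + q - 1) else 2 ^ n) \<and>
     mv.dim p_P = (if odd n then 2 ^ (n - 1) + 1 else 2 ^ (n - 1)) \<and>
     mv.dim p_PLambda =
       (if odd n \<and> n \<noteq> r \<and> r \<ge> 1 then 2 ^ (n - 1) + 2 ^ (r - 1) + 1
        else if odd n \<and> r = 0 then 2 ^ (n - 1) + 1
        else if even n \<and> r = 0 then 2 ^ (n - 1)
        else 2 ^ (n - 1) + 2 ^ (r - 1))"
proof -
  interpret geometric_algebra p q r .
  note n = assms(1) and lie = assms(3-7)
  \<comment> \<open>Besides the even sets, the families are the odd sets contributed by the
    Grassmann subalgebra, the radical and the center.\<close>
  define E where "E = {A. A \<subseteq> {1..n} \<and> even (card A)}"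
  define ON where "ON = {A. A \<subseteq> {p+q+1..n} \<and> odd (card A)}"
  define OR where "OR = {A. A \<subseteq> {1..n} \<and> A \<inter> {p+q+1..n} \<noteq> {} \<and> odd (card A)}"
  define T where "T = {A. A = {1..n} \<and> odd (card A)}"
  have even0: "even_or_in {{}} = E"
    by (auto simp: E_def n)
  have null: "even_or_in (Pow null) = E \<union> ON"
    by (auto simp: E_def ON_def n)
  have nullid: "even_or_in ({{}} \<union> {A. A \<subseteq> {1..p+q+r} \<and> A \<inter> {p+q+1..p+q+r} \<noteq> {}}) = E \<union> OR"
    by (auto simp: E_def OR_def n)
  have top: "even_or_in ({A. A \<subseteq> null \<and> even (card A)} \<union> top_odd) = E \<union> T"
    by (auto simp: E_def T_def n)
  have nulltop: "even_or_in (Pow null \<union> top_odd) = E \<union> (ON \<union> T)"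
    by (auto simp: E_def ON_def T_def n)

  have L: "has_lie_algebra (grp_Ppm p q r :: 'f mv set) E"
      "has_lie_algebra (grp_PpmLambda p q r :: 'f mv set) (E \<union> ON)"
      "has_lie_algebra (grp_Ppmrad p q r :: 'f mv set) (E \<union> OR)"
      "has_lie_algebra (grp_P p q r :: 'f mv set) (E \<union> T)"
      "has_lie_algebra (grp_PLambda p q r :: 'f mv set) (E \<union> (ON \<union> T))"
    using has_lie_algebra_Ppm has_lie_algebra_PpmLambda has_lie_algebra_Ppmrad has_lie_algebra_P
      has_lie_algebra_PLambda
    unfolding even0 null nullid top nulltop .
  have eqs: "p_pm = supported_on E" "p_pmLambda = supported_on (E \<union> ON)" "p_pmrad = supported_on (E \<union> OR)"
      "p_P = supported_on (E \<union> T)" "p_PLambda = supported_on (E \<union> (ON \<union> T))"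
    using L unfolding has_lie_algebra_def lie by blast+

  have par0: "ga_par p q r 0 = (supported_on E :: 'f mv set)"
    by (simp add: ga_par_eq_supported_on E_def n)
  have odd_eq: "{A. A \<subseteq> {1..p+q+r} \<and> (even (card A) \<longleftrightarrow> even (1::nat))} = {A. A \<subseteq> {1..n} \<and> odd (card A)}"
    by (simp add: n)
  have "Pow null \<inter> {A. A \<subseteq> {1..n} \<and> odd (card A)} = ON" by (auto simp: ON_def n)
  then have gr1: "grassmann_par p q r 1 = (supported_on ON :: 'f mv set)"
    unfolding grassmann_par_def grassmann_eq_supported_on ga_par_eq_supported_on odd_eq supported_on_Int by simp
  have "{A. A \<subseteq> idx \<and> A \<inter> null \<noteq> {}} \<inter> {A. A \<subseteq> {1..n} \<and> odd (card A)} = OR" by (auto simp: OR_def n)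
  then have rad1: "ga_rad_par p q r 1 = (supported_on OR :: 'f mv set)"
    unfolding ga_rad_par_def rad_eq_supported_on ga_par_eq_supported_on odd_eq supported_on_Int by simp
  have "A = {1..n}" if "A \<subseteq> {1..n}" "card A = n" for A
    using card_subset_eq[of "{1..n}" A] that by simp
  then have "{A. A \<subseteq> {1..p+q+r} \<and> card A = n} = {{1..n}}" by (auto simp: n)
  then have graden: "grade p q r n = (supported_on {{1..n}} :: 'f mv set)"
    unfolding grade_eq_supported_on by simp
  have T: "T = (if odd n then {{1..n}} else {})" by (auto simp: T_def)
  \<comment> \<open>If \<open>n = r\<close>, all indices are null and the top blade already lies in
    the Grassmann subalgebra; this is why \<open>p_PLambda\<close> gains no summand in that
    case.\<close>
  have T_ON: "T \<subseteq> ON" if "n = r" using that by (auto simp: T_def ON_def n)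
  have disj: "E \<inter> ON = {}" "E \<inter> OR = {}" "E \<inter> T = {}" "E \<inter> (ON \<union> T) = {}"
    by (auto simp: E_def ON_def OR_def T_def)
  have disjT: "ON \<inter> T = {}" if "n \<noteq> r"
  proof -
    \<comment> \<open>For \<open>n \<noteq> r\<close> the index \<open>1\<close> is not null, so the
      full index set is not a set of null indices.\<close>
    have "1 \<in> {1..n}" "1 \<notin> {p+q+1..n}" using that assms(1,2) by auto
    then show ?thesis by (auto simp: ON_def T_def)
  qed
  have nullT: "ON \<union> T = ON" if "\<not> (odd n \<and> n \<noteq> r)" using that T T_ON by auto

  have sums: "is_direct_sum p_pmLambda [ga_par p q r 0, grassmann_par p q r 1]"
      "is_direct_sum p_pmrad [ga_par p q r 0, ga_rad_par p q r 1]"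
      "odd n \<Longrightarrow> is_direct_sum p_P [ga_par p q r 0, grade p q r n]"
      "even n \<Longrightarrow> p_P = ga_par p q r 0"
      "odd n \<Longrightarrow> n \<noteq> r \<Longrightarrow> is_direct_sum p_PLambda [ga_par p q r 0, grassmann_par p q r 1, grade p q r n]"
      "\<not> (odd n \<and> n \<noteq> r) \<Longrightarrow> is_direct_sum p_PLambda [ga_par p q r 0, grassmann_par p q r 1]"
    unfolding eqs par0 gr1 rad1 graden
  proof -
    show "is_direct_sum (supported_on (E \<union> ON)) [supported_on E, supported_on ON :: 'f mv set]"
      "is_direct_sum (supported_on (E \<union> OR)) [supported_on E, supported_on OR :: 'f mv set]"
      by (intro is_direct_sum_Cons is_direct_sum_single disj)+
    show "is_direct_sum (supported_on (E \<union> T)) [supported_on E, supported_on {{1..n}} :: 'f mv set]" if "odd n"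
      using is_direct_sum_Cons[OF is_direct_sum_single disj(3)] that by (simp add: T)
    show "supported_on (E \<union> T) = (supported_on E :: 'f mv set)" if "even n" using that by (simp add: T)
    show "is_direct_sum (supported_on (E \<union> (ON \<union> T)))
        [supported_on E, supported_on ON, supported_on {{1..n}} :: 'f mv set]" if "odd n" "n \<noteq> r"
      using is_direct_sum_Cons[OF is_direct_sum_Cons[OF is_direct_sum_single disjT[OF that(2)]] disj(4)] that
      by (simp add: T)
    show "is_direct_sum (supported_on (E \<union> (ON \<union> T))) [supported_on E, supported_on ON :: 'f mv set]"
      if "\<not> (odd n \<and> n \<noteq> r)"
      unfolding nullT[OF that] by (intro is_direct_sum_Cons is_direct_sum_single disj)
  qed

  have sub: "E \<subseteq> Pow {1..n}" "ON \<subseteq> Pow {1..n}" "OR \<subseteq> Pow {1..n}" "T \<subseteq> Pow {1..n}"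
    by (auto simp: E_def ON_def OR_def T_def)
  have fin: "finite E" "finite ON" "finite OR" "finite T"
    using sub by (auto intro: finite_subset)
  have cE: "card E = 2 ^ (n - 1)"
    unfolding E_def using card_even_odd_subsets(1)[of "{1..n}"] assms(2) by simp
  have cON: "card ON = (if r \<ge> 1 then 2 ^ (r - 1) else 0)"
    unfolding ON_def using card_even_odd_subsets(2)[of "{p+q+1..n}"] by (simp add: n card_eq_0_iff)
  have cOR: "card OR + (if p + q = 0 then 0 else 2 ^ (p + q - 1)) = 2 ^ (n - 1)"
    unfolding OR_def n by (rule card_odd_subsets_meeting) (use assms(1,2) in linarith)
  have pow: "2 ^ n = 2 * (2 :: nat) ^ (n - 1)" using assms(2) by (cases n) auto
  have dims: "mv.dim p_pm = 2 ^ (n - 1)"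
      "mv.dim p_pmLambda = card E + card ON"
      "mv.dim p_pmrad = card E + card OR"
      "mv.dim p_P = card E + card T"
      "mv.dim p_PLambda = card E + card (ON \<union> T)"
    unfolding eqs using sub fin disj
    by (simp_all add: dim_supported_on cE card_Un_disjoint)
  have cT: "card T = (if odd n then 1 else 0)" by (simp add: T)
  have cONT: "card (ON \<union> T) = (if odd n \<and> n \<noteq> r then card ON + 1 else card ON)"
    using nullT disjT fin cT by (simp add: card_Un_disjoint)
  have dim_rad: "mv.dim p_pmrad = (if p + q \<ge> 1 then 2 ^ n - 2 ^ (p + q - 1) else 2 ^ n)"
    unfolding dims cE pow using cOR by (auto split: if_splits)
  have dim_PLambda: "mv.dim p_PLambda =
       (if odd n \<and> n \<noteq> r \<and> r \<ge> 1 then 2 ^ (n - 1) + 2 ^ (r - 1) + 1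
        else if odd n \<and> r = 0 then 2 ^ (n - 1) + 1
        else if even n \<and> r = 0 then 2 ^ (n - 1)
        else 2 ^ (n - 1) + 2 ^ (r - 1))"
    unfolding dims cE cONT cON using assms(2) by auto
  have brackets: "\<forall>(H, L) \<in> {(grp_Ppm p q r, p_pm), (grp_PpmLambda p q r, p_pmLambda),
                  (grp_Ppmrad p q r, p_pmrad), (grp_P p q r, p_P), (grp_PLambda p q r, p_PLambda)}.
        mv.subspace L \<and>
        (\<forall>X\<in>L. \<forall>Y\<in>L. ga_commutator p q r X Y \<in> L \<and>
                        is_lie_bracket p q r H X Y (ga_commutator p q r X Y))"
    using L unfolding lie has_lie_algebra_def ball_simps prod.case by blast
  have dim_pmLambda: "mv.dim p_pmLambda = (if r \<ge> 1 then 2 ^ (n - 1) + 2 ^ (r - 1) else 2 ^ (n - 1))"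
    and dim_P: "mv.dim p_P = (if odd n then 2 ^ (n - 1) + 1 else 2 ^ (n - 1))"
    by (simp_all add: dims cE cON cT)
  have p_pm: "p_pm = ga_par p q r 0" by (simp only: eqs par0)
  show ?thesis
    by (intro conjI impI brackets p_pm sums dims(1) dim_pmLambda dim_rad dim_P dim_PLambda) blast+
qed

end
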